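(* Let $\Gamma$ be a countable group acting properly by isometries on a finite product of quasi-trees. Then $\Gamma$ admits a proper uniformly Lipschitz affine action on a subspace of an $L^1$ space; that is, there exist a measure space $(\Omega,\mu)$, a closed subspace $E\subseteq L^1(\Omega,\mu)$, and a proper uniformly Lipschitz affine action of $\Gamma$ on $E$.
   Context: Groups are discrete. Graphs and quasi-trees. A connected (undirected, nonempty) graph is viewed as a metric space $(X,d)$, where $X$ is its set of vertices and $d$ is the edge-path distance. A tree is a connected graph in which every two vertices are connected by exactly one simple path. For metric spaces $(X,d_X)$, $(Y,d_Y)$ and $L\ge1$, $C>0$, a map $f:X\to Y$ is an $(L,C)$-quasi-isometry if $\frac1L d_X(x_1,x_2)-C\leq d_Y(f(x_1),f(x_2))\leq L d_X(x_1,x_2)+C$ for all $x_1,x_2\in X$, and for every $y\in Y$ there is $x\in X$ with $d_Y(f(x),y)\leq C$; $X$ and $Y$ are quasi-isometric if such a map exists for some $L\geq1$, $C>0$. A quasi-tree is a connected graph that is quasi-isometric to a tree. Products. A finite product $X=X_1\times\cdots\times X_N$ of graphs $(X_i,d_i)$ is endowed with the metric $d(x,y)=\sum_{i=1}^N d_i(x_i,y_i)$. Actions. An action of $\Gamma$ on a metric space $(X,d)$ is proper if for every $x\in X$ and every $R>0$ the set $\{s\in\Gamma : d(s\cdot x,x)\leq R\}$ is finite. Affine actions. $L^1(\Omega,\mu)$ is the real Banach space of integrable real-valued functions. An affine action $\sigma$ of $\Gamma$ on a real Banach space $E$ is given by a group homomorphism $\pi:\Gamma\to\operatorname{GL}(E)$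 (invertible bounded linear operators) and a map $b:\Gamma\to E$ satisfying $b(st)=\pi(s)b(t)+b(s)$ for all $s,t\in\Gamma$, through $\sigma(s)v=\pi(s)v+b(s)$. It is uniformly Lipschitz if there is $C\ge1$ such that $\lVert\sigma(s)v-\sigma(s)w\rVert\leq C\lVert v-w\rVert$ for all $s\in\Gamma$, $v,w\in E$. It is proper if it is proper as an action on the metric space $E$ with the norm distance. *)

theory Defs
  imports
    "HOL-Analysis.Analysis"
    "HOL-Algebra.Group_Action"
    "Graph_Theory.Pair_Digraph"
    "Graph_Theory.Digraph_Component"
    "Graph_Theory.Shortest_Path"
begin

section \<open>Graphs and quasi-trees\<close>

text \<open>
  An undirected simple graph, possibly infinite, is a symmetric loop-free digraph whose arcs are
  ordered pairs. The library predicate for connectedness also demands a nonempty vertex set.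
\<close>

definition connected_graph :: "'v pair_pre_digraph \<Rightarrow> bool" where
  "connected_graph G \<longleftrightarrow> pair_bidirected_digraph G \<and> strongly_connected (with_proj G)"

definition graph_dist :: "'v pair_pre_digraph \<Rightarrow> 'v \<Rightarrow> 'v \<Rightarrow> real" where
  "graph_dist G u v = real_of_ereal (wf_digraph.\<mu> (with_proj G) (\<lambda>_. 1) u v)"

text \<open>
  The library predicate \<open>tree\<close> forbids directed cycles, and in a symmetric digraph every edge
  yields one, hence the separate definition. The library's \<open>apath\<close> is a walk without repeated
  vertices.
\<close>

definition is_tree :: "'w pair_pre_digraph \<Rightarrow> bool" where
  "is_tree T \<longleftrightarrow> connected_graph T \<and>
     (\<forall>u\<in>pverts T. \<forall>v\<in>pverts T. \<exists>!p. pre_digraph.apath (with_proj T) u p v)"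

definition quasi_isometry ::
    "real \<Rightarrow> real \<Rightarrow> 'a set \<Rightarrow> ('a \<Rightarrow> 'a \<Rightarrow> real) \<Rightarrow> 'b set \<Rightarrow> ('b \<Rightarrow> 'b \<Rightarrow> real) \<Rightarrow> ('a \<Rightarrow> 'b) \<Rightarrow> bool"
  where
  "quasi_isometry L C X dX Y dY f \<longleftrightarrow>
     f \<in> X \<rightarrow> Y \<and>
     (\<forall>x1\<in>X. \<forall>x2\<in>X. 1 / L * dX x1 x2 - C \<le> dY (f x1) (f x2) \<and>
                     dY (f x1) (f x2) \<le> L * dX x1 x2 + C) \<and>
     (\<forall>y\<in>Y. \<exists>x\<in>X. dY (f x) y \<le> C)"

definition quasi_isometric ::
    "'a set \<Rightarrow> ('a \<Rightarrow> 'a \<Rightarrow> real) \<Rightarrow> 'b set \<Rightarrow> ('b \<Rightarrow> 'b \<Rightarrow> real) \<Rightarrow> bool" where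
  "quasi_isometric X dX Y dY \<longleftrightarrow> (\<exists>L\<ge>1. \<exists>C>0. \<exists>f. quasi_isometry L C X dX Y dY f)"

text \<open>
  The first argument names the type from which the vertices of the tree are taken. A theorem
  assuming \<open>quasi_tree TYPE('w) X\<close> for a type variable \<open>'w\<close> covers trees of every size.
\<close>

definition quasi_tree :: "'w itself \<Rightarrow> 'v pair_pre_digraph \<Rightarrow> bool" where
  "quasi_tree _ X \<longleftrightarrow> connected_graph X \<and>
     (\<exists>T :: 'w pair_pre_digraph. is_tree T \<and>
        quasi_isometric (pverts X) (graph_dist X) (pverts T) (graph_dist T))"

definition product_verts :: "nat \<Rightarrow> (nat \<Rightarrow> 'v pair_pre_digraph) \<Rightarrow> (nat \<Rightarrow> 'v) set" where
  "product_verts N X = (\<Pi>\<^sub>E i\<in>{1..N}. pverts (X i))"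

definition product_dist ::
    "nat \<Rightarrow> (nat \<Rightarrow> 'v pair_pre_digraph) \<Rightarrow> (nat \<Rightarrow> 'v) \<Rightarrow> (nat \<Rightarrow> 'v) \<Rightarrow> real" where
  "product_dist N X x y = (\<Sum>i=1..N. graph_dist (X i) (x i) (y i))"


section \<open>Actions on metric spaces\<close>

definition isometric_action ::
    "('g, 'm) monoid_scheme \<Rightarrow> 'a set \<Rightarrow> ('a \<Rightarrow> 'a \<Rightarrow> real) \<Rightarrow> ('g \<Rightarrow> 'a \<Rightarrow> 'a) \<Rightarrow> bool" where
  "isometric_action \<Gamma> X d \<phi> \<longleftrightarrow> group_action \<Gamma> X \<phi> \<and>
     (\<forall>s\<in>carrier \<Gamma>. \<forall>x\<in>X. \<forall>y\<in>X. d (\<phi> s x) (\<phi> s y) = d x y)"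

definition proper_action ::
    "('g, 'm) monoid_scheme \<Rightarrow> 'a set \<Rightarrow> ('a \<Rightarrow> 'a \<Rightarrow> real) \<Rightarrow> ('g \<Rightarrow> 'a \<Rightarrow> 'a) \<Rightarrow> bool" where
  "proper_action \<Gamma> X d \<phi> \<longleftrightarrow> (\<forall>x\<in>X. \<forall>R>0. finite {s \<in> carrier \<Gamma>. d (\<phi> s x) x \<le> R})"


section \<open>Affine actions on normed spaces with explicit carrier\<close>

record 'v normed_sp =
  vecs :: "'v set"
  vadd :: "'v \<Rightarrow> 'v \<Rightarrow> 'v"
  vscale :: "real \<Rightarrow> 'v \<Rightarrow> 'v"
  vnorm :: "'v \<Rightarrow> real"

text \<open>
  The value \<open>0\<close> outside the carrier is there because the locale \<open>Metric_space\<close> demands symmetry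
  and nonnegativity of the distance on the whole type.
\<close>

definition vdist :: "'v normed_sp \<Rightarrow> 'v \<Rightarrow> 'v \<Rightarrow> real" where
  "vdist E v w =
     (if v \<in> vecs E \<and> w \<in> vecs E then vnorm E (vadd E v (vscale E (- 1) w)) else 0)"

definition closed_subspace :: "'v set \<Rightarrow> 'v normed_sp \<Rightarrow> bool" where
  "closed_subspace S V \<longleftrightarrow> S \<subseteq> vecs V \<and> S \<noteq> {} \<and>
     (\<forall>v\<in>S. \<forall>w\<in>S. vadd V v w \<in> S) \<and> (\<forall>c. \<forall>v\<in>S. vscale V c v \<in> S) \<and>
     closedin (Metric_space.mtopology (vecs V) (vdist V)) S"

definition subspace_of :: "'v normed_sp \<Rightarrow> 'v set \<Rightarrow> 'v normed_sp" where
  "subspace_of V S = V\<lparr>vecs := S\<rparr>"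

definition bounded_linear_op :: "'v normed_sp \<Rightarrow> ('v \<Rightarrow> 'v) \<Rightarrow> bool" where
  "bounded_linear_op E T \<longleftrightarrow> T \<in> vecs E \<rightarrow> vecs E \<and>
     (\<forall>v\<in>vecs E. \<forall>w\<in>vecs E. T (vadd E v w) = vadd E (T v) (T w)) \<and>
     (\<forall>c. \<forall>v\<in>vecs E. T (vscale E c v) = vscale E c (T v)) \<and>
     (\<exists>K. \<forall>v\<in>vecs E. vnorm E (T v) \<le> K * vnorm E v)"

definition GL :: "'v normed_sp \<Rightarrow> ('v \<Rightarrow> 'v) monoid" where
  "GL E = BijGroup (vecs E)
     \<lparr>carrier := {T \<in> Bij (vecs E). bounded_linear_op E T \<and>
                                    bounded_linear_op E (inv_into (vecs E) T)}\<rparr>"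

definition affine_map :: "'v normed_sp \<Rightarrow> ('g \<Rightarrow> 'v \<Rightarrow> 'v) \<Rightarrow> ('g \<Rightarrow> 'v) \<Rightarrow> 'g \<Rightarrow> 'v \<Rightarrow> 'v" where
  "affine_map E \<pi> b s v = vadd E (\<pi> s v) (b s)"

definition affine_action ::
    "('g, 'm) monoid_scheme \<Rightarrow> 'v normed_sp \<Rightarrow> ('g \<Rightarrow> 'v \<Rightarrow> 'v) \<Rightarrow> ('g \<Rightarrow> 'v) \<Rightarrow> bool" where
  "affine_action \<Gamma> E \<pi> b \<longleftrightarrow> \<pi> \<in> hom \<Gamma> (GL E) \<and> b \<in> carrier \<Gamma> \<rightarrow> vecs E \<and>
     (\<forall>s\<in>carrier \<Gamma>. \<forall>t\<in>carrier \<Gamma>. b (s \<otimes>\<^bsub>\<Gamma>\<^esub> t) = vadd E (\<pi> s (b t)) (b s))"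

definition uniformly_Lipschitz ::
    "('g, 'm) monoid_scheme \<Rightarrow> 'v normed_sp \<Rightarrow> ('g \<Rightarrow> 'v \<Rightarrow> 'v) \<Rightarrow> bool" where
  "uniformly_Lipschitz \<Gamma> E \<sigma> \<longleftrightarrow>
     (\<exists>C\<ge>1. \<forall>s\<in>carrier \<Gamma>. \<forall>v\<in>vecs E. \<forall>w\<in>vecs E. vdist E (\<sigma> s v) (\<sigma> s w) \<le> C * vdist E v w)"


section \<open>The Banach space of integrable functions modulo null sets\<close>

text \<open>
  For a countable group it is no loss to look for a measure space among measures on subsets of
  the type \<open>real\<close>: the closed linear span of \<open>b(\<Gamma>)\<close> is an invariant separable subspace on which an
  affine action stays proper, and separable subspaces of \<open>L\<^sup>1\<close> spaces embed isometrically in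
  \<open>L\<^sup>1([0,1])\<close>.
\<close>

definition L1_class :: "'a measure \<Rightarrow> ('a \<Rightarrow> real) \<Rightarrow> ('a \<Rightarrow> real) set" where
  "L1_class M f = {g. integrable M g \<and> (AE x in M. g x = f x)}"

definition L1 :: "'a measure \<Rightarrow> ('a \<Rightarrow> real) set normed_sp" where
  "L1 M = \<lparr>
     vecs = L1_class M ` {f. integrable M f},
     vadd = (\<lambda>F G. \<Union>f\<in>F. \<Union>g\<in>G. L1_class M (\<lambda>x. f x + g x)),
     vscale = (\<lambda>c F. \<Union>f\<in>F. L1_class M (\<lambda>x. c * f x)),
     vnorm = (\<lambda>F. \<integral>x. \<bar>(SOME f. f \<in> F) x\<bar> \<partial>M)\<rparr>"

text \<open>The operations are independent of representatives, and the norm distance is a metric.\<close>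

lemma L1_class_self: "integrable M f \<Longrightarrow> f \<in> L1_class M f"
  by (simp add: L1_class_def)

lemma L1_class_cong:
  assumes "AE x in M. f x = g x"
  shows "L1_class M f = L1_class M g"
proof -
  have "(AE x in M. h x = f x) \<longleftrightarrow> (AE x in M. h x = g x)" for h
  proof
    assume "AE x in M. h x = f x"
    with assms show "AE x in M. h x = g x" by eventually_elim simp
  next
    assume "AE x in M. h x = g x"
    with assms show "AE x in M. h x = f x" by eventually_elim simp
  qed
  then show ?thesis by (simp add: L1_class_def)
qed

lemma L1_vadd:
  assumes "integrable M f" "integrable M g"
  shows "vadd (L1 M) (L1_class M f) (L1_class M g) = L1_class M (\<lambda>x. f x + g x)"
proof -
  have "L1_class M (\<lambda>x. f' x + g' x) = L1_class M (\<lambda>x. f x + g x)"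
    if "f' \<in> L1_class M f" "g' \<in> L1_class M g" for f' g'
  proof (rule L1_class_cong)
    have "AE x in M. f' x = f x" "AE x in M. g' x = g x" using that by (auto simp: L1_class_def)
    then show "AE x in M. f' x + g' x = f x + g x" by eventually_elim simp
  qed
  then have "vadd (L1 M) (L1_class M f) (L1_class M g) =
      (\<Union>f'\<in>L1_class M f. \<Union>g'\<in>L1_class M g. L1_class M (\<lambda>x. f x + g x))"
    unfolding L1_def normed_sp.simps by (intro SUP_cong refl) blast
  then show ?thesis using L1_class_self[OF assms(1)] L1_class_self[OF assms(2)]
    by blast
qed

lemma L1_vscale:
  assumes "integrable M f"
  shows "vscale (L1 M) c (L1_class M f) = L1_class M (\<lambda>x. c * f x)"
proof -
  have "L1_class M (\<lambda>x. c * f' x) = L1_class M (\<lambda>x. c * f x)" if "f' \<in> L1_class M f" for f'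
  proof (rule L1_class_cong)
    have "AE x in M. f' x = f x" using that by (auto simp: L1_class_def)
    then show "AE x in M. c * f' x = c * f x" by eventually_elim simp
  qed
  then have "vscale (L1 M) c (L1_class M f) = (\<Union>f'\<in>L1_class M f. L1_class M (\<lambda>x. c * f x))"
    unfolding L1_def normed_sp.simps by (intro SUP_cong refl) blast
  then show ?thesis using L1_class_self[OF assms] by blast
qed

lemma L1_vnorm:
  assumes "integrable M f"
  shows "vnorm (L1 M) (L1_class M f) = (\<integral>x. \<bar>f x\<bar> \<partial>M)"
proof -
  define g where "g = (SOME g. g \<in> L1_class M f)"
  have "g \<in> L1_class M f" unfolding g_def by (rule someI[where P = "\<lambda>g. g \<in> L1_class M f", OF L1_class_self[OF assms]])
  then have g: "integrable M g" "AE x in M. g x = f x" by (auto simp: L1_class_def)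
  then have "AE x in M. \<bar>g x\<bar> = \<bar>f x\<bar>" by auto
  then have "(\<integral>x. \<bar>g x\<bar> \<partial>M) = (\<integral>x. \<bar>f x\<bar> \<partial>M)"
    using g assms by (intro integral_cong_AE) auto
  then show ?thesis by (simp add: L1_def g_def)
qed

lemma L1_vdist:
  assumes "integrable M f" "integrable M g"
  shows "vdist (L1 M) (L1_class M f) (L1_class M g) = (\<integral>x. \<bar>f x - g x\<bar> \<partial>M)"
proof -
  have "L1_class M f \<in> vecs (L1 M)" "L1_class M g \<in> vecs (L1 M)"
    using assms by (auto simp: L1_def)
  with assms show ?thesis by (simp add: vdist_def L1_vscale L1_vadd L1_vnorm)
qed

lemma L1_vecsE:
  assumes "F \<in> vecs (L1 M)"
  obtains f where "integrable M f" "F = L1_class M f"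
  using assms unfolding L1_def normed_sp.simps by blast

lemma L1_Metric_space: "Metric_space (vecs (L1 M)) (vdist (L1 M))"
proof
  fix F G
  show "0 \<le> vdist (L1 M) F G" by (simp add: vdist_def L1_def)
next
  fix F G
  show "vdist (L1 M) F G = vdist (L1 M) G F"
  proof (cases "F \<in> vecs (L1 M) \<and> G \<in> vecs (L1 M)")
    case True
    then obtain f g where "integrable M f" "F = L1_class M f" "integrable M g" "G = L1_class M g"
      by (meson L1_vecsE)
    then show ?thesis by (simp add: L1_vdist abs_minus_commute)
  next
    case False
    then show ?thesis unfolding vdist_def by argo
  qed
next
  fix F G assume F: "F \<in> vecs (L1 M)" and G: "G \<in> vecs (L1 M)"
  obtain f where f: "integrable M f" "F = L1_class M f" using F by (rule L1_vecsE)
  obtain g where g: "integrable M g" "G = L1_class M g" using G by (rule L1_vecsE)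
  show "(vdist (L1 M) F G = 0) = (F = G)"
  proof
    assume "vdist (L1 M) F G = 0"
    then have "(\<integral>x. \<bar>f x - g x\<bar> \<partial>M) = 0" using f g by (simp add: L1_vdist)
    moreover have "integrable M (\<lambda>x. \<bar>f x - g x\<bar>)" using f g by simp
    ultimately have "AE x in M. \<bar>f x - g x\<bar> = 0"
      using integral_nonneg_eq_0_iff_AE[of M "\<lambda>x. \<bar>f x - g x\<bar>"] by simp
    then have "AE x in M. f x = g x" by simp
    then show "F = G" unfolding f(2) g(2) by (rule L1_class_cong)
  next
    assume "F = G"
    then show "vdist (L1 M) F G = 0" using L1_vdist[OF f(1) f(1)] f(2) by simp
  qed
next
  fix F G H assume F: "F \<in> vecs (L1 M)" and G: "G \<in> vecs (L1 M)" and H: "H \<in> vecs (L1 M)"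
  obtain f where f: "integrable M f" "F = L1_class M f" using F by (rule L1_vecsE)
  obtain g where g: "integrable M g" "G = L1_class M g" using G by (rule L1_vecsE)
  obtain h where h: "integrable M h" "H = L1_class M h" using H by (rule L1_vecsE)
  have "(\<integral>x. \<bar>f x - h x\<bar> \<partial>M) \<le> (\<integral>x. \<bar>f x - g x\<bar> + \<bar>g x - h x\<bar> \<partial>M)"
    using f(1) g(1) h(1) by (intro integral_mono) auto
  also have "\<dots> = (\<integral>x. \<bar>f x - g x\<bar> \<partial>M) + (\<integral>x. \<bar>g x - h x\<bar> \<partial>M)"
    using f(1) g(1) h(1) by (intro Bochner_Integration.integral_add) auto
  finally show "vdist (L1 M) F H \<le> vdist (L1 M) F G + vdist (L1 M) G H"
    unfolding f(2) g(2) h(2) L1_vdist[OF f(1) h(1)] L1_vdist[OF f(1) g(1)] L1_vdist[OF g(1) h(1)] .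
qed

end

theory Submission
  imports Defs
begin

text \<open>
  In the product graph, edges in different directions are not related by the Djokovic--Winkler
  relation, so colouring an edge by the directions of all its \<open>\<Gamma>\<close>-translates is an invariant
  colouring to which the Graham--Winkler argument applies: the number \<open>D c x y\<close> of edges of colour
  \<open>c\<close> on a geodesic from \<open>x\<close> to \<open>y\<close> is a pseudometric, these pseudometrics add up to the distance of
  the product, and \<open>\<Gamma>\<close> permutes them. Each of them is dominated by the distance of a single factor
  and additive along geodesics of the product, so the thinness of triangles in a quasi-tree makes
  the layers of \<open>D c\<close> around a base point (components of \<open>{x. k \<le> D c b0 x}\<close>, restricted to
  level \<open>k\<close>) uniformly bounded. The layering tree therefore carries finitely supported indicator
  vectors \<open>F x\<close> in \<open>\<ell>\<^sup>1\<close> of the set of all components, with \<open>F b0 = 0\<close> and \<open>\<parallel>F x\<parallel>\<close> at least the distance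
  from \<open>b0\<close> to \<open>x\<close>. Sending a component to the difference \<open>F (g p) - F (g q)\<close>, where \<open>p\<close>, \<open>q\<close> are
  representatives of it and of its parent, is an operator on \<open>\<ell>\<^sup>1\<close> of norm bounded independently
  of \<open>g\<close>, and telescoping shows that it maps \<open>F x\<close> to \<open>F (g x) - F (g b0)\<close>. So \<open>g \<mapsto> F (g b0)\<close> is the
  required cocycle on the subspace where these operators compose like the group.
\<close>

section \<open>Graph metrics and walks\<close>

text \<open>The list leaves out the starting vertex: its length counts edges, and the walk visits
  \<open>insert x (set xs)\<close>.\<close>

fun chain :: "('a \<Rightarrow> 'a \<Rightarrow> bool) \<Rightarrow> 'a \<Rightarrow> 'a list \<Rightarrow> 'a \<Rightarrow> bool" where
  "chain R x [] y \<longleftrightarrow> x = y"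
| "chain R x (z # zs) y \<longleftrightarrow> R x z \<and> chain R z zs y"

lemma chain_append: "chain R x (xs @ ys) y \<longleftrightarrow> (\<exists>z. chain R x xs z \<and> chain R z ys y)"
  by (induction xs arbitrary: x) auto

lemma chain_map: "chain R x xs y \<Longrightarrow> (\<And>u v. R u v \<Longrightarrow> S (f u) (f v)) \<Longrightarrow> chain S (f x) (map f xs) (f y)"
  by (induction xs arbitrary: x) auto

lemma chain_mono: "chain R x xs y \<Longrightarrow> (\<And>u v. R u v \<Longrightarrow> S u v) \<Longrightarrow> chain S x xs y"
  by (induction xs arbitrary: x) auto

lemma chain_in: "chain R x xs y \<Longrightarrow> (\<And>u v. R u v \<Longrightarrow> v \<in> V) \<Longrightarrow> x \<in> V \<Longrightarrow> insert x (set xs) \<subseteq> V"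
  by (induction xs arbitrary: x) auto

lemma chain_last: "chain R x xs y \<Longrightarrow> y \<in> insert x (set xs)"
  by (induction xs arbitrary: x) auto

lemma chain_split:
  "chain R x xs y \<Longrightarrow> z \<in> insert x (set xs) \<Longrightarrow>
    \<exists>ps qs. xs = ps @ qs \<and> chain R x ps z \<and> chain R z qs y"
proof (induction xs arbitrary: x)
  case (Cons w ws)
  show ?case
  proof (cases "z = x")
    case True
    with Cons.prems show ?thesis by (intro exI[of _ "[]"] exI[of _ "w # ws"]) auto
  next
    case False
    with Cons.prems have "chain R w ws y" "z \<in> insert w (set ws)" by auto
    then obtain ps qs where "ws = ps @ qs" "chain R w ps z" "chain R z qs y" using Cons.IH by blast
    with Cons.prems show ?thesis by (intro exI[of _ "w # ps"] exI[of _ qs]) auto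
  qed
qed auto

text \<open>\<open>d_step\<close> makes an integer-valued metric the path metric of the graph whose
  edges join points at distance 1. This form applies alike to the factors, to their product and to a
  suitable subset of its vertices.\<close>

locale graph_metric =
  fixes V :: "'a set" and d :: "'a \<Rightarrow> 'a \<Rightarrow> nat"
  assumes d_zero: "x \<in> V \<Longrightarrow> y \<in> V \<Longrightarrow> d x y = 0 \<longleftrightarrow> x = y"
    and d_sym: "x \<in> V \<Longrightarrow> y \<in> V \<Longrightarrow> d x y = d y x"
    and d_tri: "x \<in> V \<Longrightarrow> y \<in> V \<Longrightarrow> z \<in> V \<Longrightarrow> d x z \<le> d x y + d y z"
    and d_step: "x \<in> V \<Longrightarrow> y \<in> V \<Longrightarrow> x \<noteq> y \<Longrightarrow> \<exists>z\<in>V. d x z = 1 \<and> d x y = Suc (d z y)"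
begin

definition adj :: "'a \<Rightarrow> 'a \<Rightarrow> bool" where "adj u v \<longleftrightarrow> u \<in> V \<and> v \<in> V \<and> d u v = 1"

lemma adjD: "adj u v \<Longrightarrow> u \<in> V" "adj u v \<Longrightarrow> v \<in> V" "adj u v \<Longrightarrow> d u v = 1"
  by (auto simp: adj_def)

lemma d_refl: "x \<in> V \<Longrightarrow> d x x = 0"
  by (simp add: d_zero)

lemma adj_sym: "adj u v \<Longrightarrow> adj v u"
  by (auto simp: adj_def d_sym)

lemma chain_adj_in: "chain adj x P y \<Longrightarrow> x \<in> V \<Longrightarrow> insert x (set P) \<subseteq> V"
  by (erule chain_in) (auto simp: adj_def)

lemma chain_adj_end: "chain adj x P y \<Longrightarrow> x \<in> V \<Longrightarrow> y \<in> V"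
  using chain_adj_in chain_last by fastforce

lemma chain_length: "chain adj x P y \<Longrightarrow> x \<in> V \<Longrightarrow> d x y \<le> length P"
proof (induction P arbitrary: x)
  case (Cons z P)
  then have z: "z \<in> V" "d x z = 1" and c: "chain adj z P y" by (auto dest: adjD)
  then have "d x y \<le> d x z + d z y" using d_tri Cons.prems chain_adj_end by blast
  with Cons.IH[OF c] z show ?case by simp
qed (simp add: d_zero)

definition geod :: "'a \<Rightarrow> 'a list \<Rightarrow> 'a \<Rightarrow> bool" where
  "geod x P y \<longleftrightarrow> chain adj x P y \<and> length P = d x y"

lemma geod_ex: "x \<in> V \<Longrightarrow> y \<in> V \<Longrightarrow> \<exists>P. geod x P y"
proof (induction "d x y" arbitrary: x)
  case 0
  then show ?case using d_zero by (intro exI[of _ "[]"]) (auto simp: geod_def)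
next
  case (Suc n)
  then have "x \<noteq> y" using d_zero by fastforce
  then obtain z where z: "z \<in> V" "d x z = 1" "d x y = Suc (d z y)" using d_step Suc by blast
  then obtain P where "geod z P y" using Suc by fastforce
  with z Suc show ?case by (intro exI[of _ "z # P"]) (auto simp: geod_def adj_def)
qed

lemma geod_between:
  assumes "geod x P y" "z \<in> insert x (set P)" "x \<in> V"
  shows "z \<in> V" "d x z + d z y = d x y"
proof -
  obtain ps qs where P: "P = ps @ qs" "chain adj x ps z" "chain adj z qs y"
    using chain_split assms unfolding geod_def by metis
  show z: "z \<in> V" using P(2) assms(3) by (rule chain_adj_end)
  have y: "y \<in> V" using P(3) z by (rule chain_adj_end)
  have "d x z \<le> length ps" "d z y \<le> length qs" using P chain_length assms z by auto
  moreover have "d x y \<le> d x z + d z y" using d_tri z y assms by blast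
  ultimately show "d x z + d z y = d x y" using assms P by (auto simp: geod_def)
qed

lemma geod_append:
  assumes "geod x P z" "geod z Q y" "d x z + d z y = d x y"
  shows "geod x (P @ Q) y"
  using assms by (auto simp: geod_def chain_append)

text \<open>Serves to pass to a countable invariant set of vertices of the product.\<close>

lemma graph_metric_subset:
  assumes "U \<subseteq> V" "\<And>x y. x \<in> U \<Longrightarrow> y \<in> U \<Longrightarrow> x \<noteq> y \<Longrightarrow> \<exists>z\<in>U. d x z = 1 \<and> d x y = Suc (d z y)"
  shows "graph_metric U d"
proof (rule graph_metric.intro)
  show "d x y = 0 \<longleftrightarrow> x = y" "d x y = d y x" if "x \<in> U" "y \<in> U" for x y
    using that assms(1) by (auto intro!: d_zero d_sym)
  show "d x z \<le> d x y + d y z" if "x \<in> U" "y \<in> U" "z \<in> U" for x y z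
    using d_tri[of x y z] assms(1) that by auto
qed (rule assms(2))

lemma chain_rev_set: "chain adj x P y \<Longrightarrow> \<exists>Q. chain adj y Q x \<and> insert y (set Q) = insert x (set P)"
proof (induction P arbitrary: x)
  case (Cons z P)
  then obtain Q where "chain adj y Q z" "insert y (set Q) = insert z (set P)" by auto
  with Cons.prems show ?case by (intro exI[of _ "Q @ [x]"]) (auto simp: chain_append adj_sym)
qed (auto intro: exI[of _ "[]"])

end

section \<open>The Graham--Winkler pseudometrics of a coloured graph\<close>

text \<open>The inequality between the two sums is the Djokovic--Winkler relation, so each colour
  class is a union of classes of its transitive closure.\<close>

locale coloured_graph_metric = graph_metric V d
  for V :: "'a set" and d +
  fixes col :: "'a \<Rightarrow> 'a \<Rightarrow> 'c"
  assumes theta: "adj u v \<Longrightarrow> adj a b \<Longrightarrow> d u a + d v b \<noteq> d u b + d v a \<Longrightarrow> col u v = col a b"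
begin

text \<open>An edge is related to its own reversal: the two sums are 2 and 0.\<close>

lemma col_sym: "adj u v \<Longrightarrow> col u v = col v u"
  by (intro theta) (auto simp: adj_def d_refl d_sym)

primrec cnt :: "'c \<Rightarrow> 'a \<Rightarrow> 'a list \<Rightarrow> nat" where
  "cnt c x [] = 0"
| "cnt c x (z # zs) = (if col x z = c then 1 else 0) + cnt c z zs"

lemma cnt_append: "chain R x xs z \<Longrightarrow> cnt c x (xs @ ys) = cnt c x xs + cnt c z ys"
  by (induction xs arbitrary: x) auto

lemma cnt_rev: "chain adj x P y \<Longrightarrow> \<exists>Q. chain adj y Q x \<and> length Q = length P \<and> (\<forall>c. cnt c y Q = cnt c x P)"
proof (induction P arbitrary: x)
  case (Cons z P)
  then obtain Q where Q: "chain adj y Q z" "length Q = length P" "\<forall>c. cnt c y Q = cnt c z P" by auto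
  with Cons.prems show ?case
    by (intro exI[of _ "Q @ [x]"]) (auto simp: chain_append adj_sym cnt_append[OF Q(1)] col_sym)
qed simp

text \<open>Signed defect of the Djokovic--Winkler relation: it vanishes exactly on unrelated edges
  and telescopes along walks in the pair \<open>u\<close>, \<open>v\<close> as well as in the pair
  \<open>a\<close>, \<open>b\<close>.\<close>

definition \<theta> :: "'a \<Rightarrow> 'a \<Rightarrow> 'a \<Rightarrow> 'a \<Rightarrow> int" where
  "\<theta> u v a b = int (d u a) - int (d v a) - int (d u b) + int (d v b)"

primrec theta_sum :: "'c \<Rightarrow> 'a \<Rightarrow> 'a list \<Rightarrow> 'a \<Rightarrow> 'a \<Rightarrow> int" where
  "theta_sum c x [] a b = 0"
| "theta_sum c x (z # zs) a b = (if col x z = c then \<theta> x z a b else 0) + theta_sum c z zs a b"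

lemma theta_sum_refl: "theta_sum c x P a a = 0"
  by (induction P arbitrary: x) (auto simp: \<theta>_def)

lemma theta_sum_add: "theta_sum c x P a b + theta_sum c x P b b' = theta_sum c x P a b'"
  by (induction P arbitrary: x) (auto simp: \<theta>_def algebra_simps)

text \<open>Each edge of a geodesic from \<open>x\<close> to \<open>y\<close> leads one step away
  from \<open>x\<close> and one step closer to \<open>y\<close>, so its defect against
  \<open>x\<close>, \<open>y\<close> is -2. Letting \<open>P\<close> be a final piece of the
  geodesic makes the induction work.\<close>

lemma theta_sum_geod:
  assumes "chain adj u P y" "d x u + length P = d x y" "x \<in> V" "u \<in> V"
  shows "theta_sum c u P x y = - 2 * int (cnt c u P)"
  using assms
proof (induction P arbitrary: u)
  case (Cons v P)
  have v: "v \<in> V" "d u v = 1" "chain adj v P y" using Cons.prems by (auto dest: adjD)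
  have y: "y \<in> V" using chain_adj_end v by blast
  have 1: "d x v \<le> d x u + 1" using d_tri[of x u v] v Cons by simp
  have 2: "d x y \<le> d x v + d v y" using d_tri v y Cons by blast
  have 3: "d v y \<le> length P" using chain_length v by blast
  have 4: "d u y \<le> Suc (length P)" using chain_length Cons by fastforce
  have 5: "d x y \<le> d x u + d u y" using d_tri y Cons by blast
  have s: "d x u = d u x" "d x v = d v x" using d_sym v Cons by blast+
  have "\<theta> u v x y = -2" using 1 2 3 4 5 s Cons.prems(2) unfolding \<theta>_def by simp
  moreover have "theta_sum c v P x y = - 2 * int (cnt c v P)"
    using 1 2 3 Cons v by (intro Cons.IH) auto
  ultimately show ?case by simp
qed auto

lemma theta_sum_other:
  assumes "chain adj x P y" "adj a b" "col a b \<noteq> c"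
  shows "theta_sum c x P a b = 0"
  using assms
proof (induction P arbitrary: x)
  case (Cons z P)
  have "\<theta> x z a b = 0" if "col x z = c"
    using theta[of x z a b] that Cons.prems unfolding \<theta>_def by (cases "d x a + d z b = d x b + d z a") auto
  with Cons show ?case by auto
qed auto

text \<open>Edges of other colours are unrelated to \<open>a\<close>, \<open>b\<close> and
  contribute 0, so the sum may as well run over all of \<open>P\<close>, where it
  telescopes.\<close>

lemma theta_sum_same:
  assumes "chain adj x P y" "adj a b" "col a b = c"
  shows "theta_sum c x P a b = \<theta> x y a b"
  using assms
proof (induction P arbitrary: x)
  case (Cons z P)
  have "\<theta> x z a b = 0" if "col x z \<noteq> c"
    using theta[of x z a b] that Cons.prems unfolding \<theta>_def by (cases "d x a + d z b = d x b + d z a") auto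
  with Cons have "theta_sum c x (z # P) a b = \<theta> x z a b + \<theta> z y a b" by auto
  then show ?case by (simp add: \<theta>_def)
qed (auto simp: \<theta>_def)

lemma \<theta>_bound:
  assumes "adj a b" "x \<in> V" "y \<in> V"
  shows "\<bar>\<theta> x y a b\<bar> \<le> 2"
proof -
  have "d x a \<le> d x b + 1" "d x b \<le> d x a + 1" "d y a \<le> d y b + 1" "d y b \<le> d y a + 1"
    using d_tri[of x b a] d_tri[of x a b] d_tri[of y b a] d_tri[of y a b] assms d_sym[of a b]
    by (auto simp: adj_def)
  then show ?thesis by (auto simp: \<theta>_def)
qed

text \<open>Split the pair \<open>a\<close>, \<open>b\<close> along \<open>Q\<close>: an edge of
  \<open>Q\<close> of another colour contributes 0, and one of colour \<open>c\<close> at most 2 in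
  absolute value, by \<open>theta_sum_same\<close> and \<open>\<theta>_bound\<close>.\<close>

lemma theta_sum_bound:
  assumes "chain adj x P y" "x \<in> V" "chain adj a Q b"
  shows "\<bar>theta_sum c x P a b\<bar> \<le> 2 * int (cnt c a Q)"
  using assms(3)
proof (induction Q arbitrary: a)
  case Nil
  then show ?case by (simp add: theta_sum_refl)
next
  case (Cons z Q)
  have *: "theta_sum c x P a b = theta_sum c x P a z + theta_sum c x P z b" by (simp add: theta_sum_add)
  have y: "y \<in> V" using assms chain_adj_end by blast
  have "\<bar>theta_sum c x P a z\<bar> \<le> 2 * (if col a z = c then 1 else 0)"
    using theta_sum_other[OF assms(1), of a z c] theta_sum_same[OF assms(1), of a z c] Cons.prems \<theta>_bound[OF _ assms(2) y, of a z]
    by auto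
  moreover have "\<bar>theta_sum c x P z b\<bar> \<le> 2 * int (cnt c z Q)" using Cons by simp
  ultimately show ?case unfolding * by (auto split: if_splits)
qed

text \<open>The Graham--Winkler argument: the defects of the \<open>c\<close>-edges of
  \<open>P\<close> against the pair \<open>x\<close>, \<open>y\<close> are summed exactly along
  \<open>P\<close> and estimated along \<open>Q\<close>.\<close>

lemma cnt_geod_le:
  assumes "geod x P y" "x \<in> V" "chain adj x Q y"
  shows "cnt c x P \<le> cnt c x Q"
proof -
  have "theta_sum c x P x y = - 2 * int (cnt c x P)"
    using assms by (intro theta_sum_geod) (auto simp: geod_def d_zero)
  moreover have "\<bar>theta_sum c x P x y\<bar> \<le> 2 * int (cnt c x Q)"
    using assms by (intro theta_sum_bound[of _ _ y]) (auto simp: geod_def)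
  ultimately show ?thesis by linarith
qed

text \<open>The choice of geodesic does not matter, since \<open>cnt_geod_le\<close> compares any
  two of them in both directions.\<close>

definition D :: "'c \<Rightarrow> 'a \<Rightarrow> 'a \<Rightarrow> nat" where
  "D c x y = cnt c x (SOME P. geod x P y)"

lemma D_geod: "geod x P y \<Longrightarrow> x \<in> V \<Longrightarrow> D c x y = cnt c x P"
proof -
  assume P: "geod x P y" "x \<in> V"
  then have "geod x (SOME P. geod x P y) y" by (metis someI)
  with P show ?thesis unfolding D_def geod_def
    by (intro antisym cnt_geod_le) (auto simp: geod_def)
qed

lemma D_le_cnt: "chain adj x Q y \<Longrightarrow> x \<in> V \<Longrightarrow> D c x y \<le> cnt c x Q"
  using geod_ex[of x y] chain_adj_end[of x Q y] D_geod[of x _ y c] cnt_geod_le by metis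

lemma D_refl: "x \<in> V \<Longrightarrow> D c x x = 0"
  using D_geod[of x "[]" x] by (simp add: geod_def d_zero)

lemma D_sym: "x \<in> V \<Longrightarrow> y \<in> V \<Longrightarrow> D c x y = D c y x"
proof -
  assume xy: "x \<in> V" "y \<in> V"
  obtain P where P: "geod x P y" using geod_ex xy by blast
  then obtain Q where Q: "chain adj y Q x" "length Q = length P" "\<forall>c. cnt c y Q = cnt c x P"
    using cnt_rev unfolding geod_def by metis
  then have "geod y Q x" using P xy by (auto simp: geod_def d_sym)
  with P Q xy show ?thesis by (simp add: D_geod)
qed

lemma D_add:
  assumes "x \<in> V" "y \<in> V" "z \<in> V" "d x z + d z y = d x y"
  shows "D c x y = D c x z + D c z y"
proof -
  obtain P Q where PQ: "geod x P z" "geod z Q y" using geod_ex assms by metis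
  with assms geod_append have "geod x (P @ Q) y" by blast
  with PQ assms show ?thesis by (simp add: D_geod) (auto simp: geod_def intro: cnt_append)
qed

lemma D_tri:
  assumes "x \<in> V" "y \<in> V" "z \<in> V"
  shows "D c x y \<le> D c x z + D c z y"
proof -
  obtain P Q where PQ: "geod x P z" "geod z Q y" using geod_ex assms by metis
  then have "chain adj x (P @ Q) y" by (auto simp: geod_def chain_append)
  then have "D c x y \<le> cnt c x (P @ Q)" using assms by (intro D_le_cnt)
  also have "\<dots> = cnt c x P + cnt c z Q" using PQ cnt_append by (auto simp: geod_def)
  finally show ?thesis using PQ assms by (simp add: D_geod)
qed

lemma D_adj: "adj x y \<Longrightarrow> D c x y = (if col x y = c then 1 else 0)"
  using D_geod[of x "[y]" y] by (auto simp: geod_def adj_def)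

text \<open>There may be infinitely many colours, so the sum runs over a finite set containing those
  that occur on \<open>P\<close>.\<close>

lemma cnt_sum:
  assumes "chain adj x P y"
  shows "\<exists>C. finite C \<and> (\<forall>c. c \<notin> C \<longrightarrow> cnt c x P = 0) \<and> (\<Sum>c\<in>C. cnt c x P) = length P"
  using assms
proof (induction P arbitrary: x)
  case (Cons z P)
  then obtain C where C: "finite C" "\<forall>c. c \<notin> C \<longrightarrow> cnt c z P = 0" "(\<Sum>c\<in>C. cnt c z P) = length P" by auto
  let ?C = "insert (col x z) C"
  have "(\<Sum>c\<in>?C. cnt c x (z # P)) = (\<Sum>c\<in>?C. if col x z = c then 1 else 0) + (\<Sum>c\<in>?C. cnt c z P)"
    by (simp add: sum.distrib)
  also have "(\<Sum>c\<in>?C. cnt c z P) = (\<Sum>c\<in>C. cnt c z P)"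
    using C by (intro sum.mono_neutral_right) auto
  also have "(\<Sum>c\<in>?C. if col x z = c then 1 else (0::nat)) = 1" using C by simp
  finally show ?case using C by (intro exI[of _ ?C]) auto
qed auto

lemma D_sum:
  assumes "x \<in> V" "y \<in> V"
  obtains C where "finite C" "\<And>c. c \<notin> C \<Longrightarrow> D c x y = 0" "(\<Sum>c\<in>C. D c x y) = d x y"
proof -
  obtain P where P: "geod x P y" using geod_ex assms by metis
  then obtain C where "finite C" "\<forall>c. c \<notin> C \<longrightarrow> cnt c x P = 0" "(\<Sum>c\<in>C. cnt c x P) = length P"
    using cnt_sum unfolding geod_def by metis
  with P assms show thesis by (intro that[of C]) (auto simp: D_geod geod_def)
qed

end

section \<open>The layering tree of a coloured pseudometric\<close>

text \<open>\<open>tripod\<close> asks for thin triangles whose sides are arbitrary walks, measured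
  by each \<open>D c\<close>, with one bound \<open>B\<close> for all colours.\<close>

locale layered_graph_metric = coloured_graph_metric V d col
  for V :: "'a set" and d and col :: "'a \<Rightarrow> 'a \<Rightarrow> 'c" +
  fixes b0 :: 'a and B :: nat
  assumes base: "b0 \<in> V"
    and tripod: "chain adj x xs y \<Longrightarrow> chain adj b0 ps x \<Longrightarrow> chain adj b0 qs y \<Longrightarrow>
      \<exists>z\<in>insert x (set xs). \<exists>p\<in>insert b0 (set ps). \<exists>q\<in>insert b0 (set qs). D c z p \<le> B \<and> D c z q \<le> B"
begin

abbreviation lev :: "'c \<Rightarrow> 'a \<Rightarrow> nat" where "lev c x \<equiv> D c b0 x"

definition conn :: "'c \<Rightarrow> nat \<Rightarrow> 'a \<Rightarrow> 'a \<Rightarrow> bool" where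
  "conn c k x y \<longleftrightarrow> (\<exists>xs. chain adj x xs y \<and> (\<forall>z\<in>insert x (set xs). z \<in> V \<and> k \<le> lev c z))"

lemma conn_in: "conn c k x y \<Longrightarrow> x \<in> V \<and> k \<le> lev c x \<and> y \<in> V \<and> k \<le> lev c y"
  unfolding conn_def using chain_last by fastforce

lemma conn_refl: "x \<in> V \<Longrightarrow> k \<le> lev c x \<Longrightarrow> conn c k x x"
  unfolding conn_def by (intro exI[of _ "[]"]) auto

lemma conn_trans: "conn c k x y \<Longrightarrow> conn c k y z \<Longrightarrow> conn c k x z"
  unfolding conn_def
proof (elim exE conjE)
  fix xs ys
  assume "chain adj x xs y" "chain adj y ys z"
    "\<forall>z\<in>insert x (set xs). z \<in> V \<and> k \<le> lev c z" "\<forall>z\<in>insert y (set ys). z \<in> V \<and> k \<le> lev c z"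
  then show "\<exists>xs. chain adj x xs z \<and> (\<forall>z\<in>insert x (set xs). z \<in> V \<and> k \<le> lev c z)"
    by (intro exI[of _ "xs @ ys"]) (auto simp: chain_append)
qed

lemma conn_sym: "conn c k x y \<Longrightarrow> conn c k y x"
  unfolding conn_def using chain_rev_set by metis

lemma conn_mono: "conn c k x y \<Longrightarrow> j \<le> k \<Longrightarrow> conn c j x y"
  unfolding conn_def by (meson order_trans)

lemma conn_eq: "conn c k x y \<Longrightarrow> conn c k x = conn c k y"
  using conn_trans conn_sym by blast

lemma conn_between:
  assumes "x \<in> V" "y \<in> V" "\<And>z. z \<in> V \<Longrightarrow> d x z + d z y = d x y \<Longrightarrow> k \<le> lev c z"
  shows "conn c k x y"
proof -
  obtain P where "geod x P y" using geod_ex assms by blast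
  with assms geod_between show ?thesis unfolding conn_def geod_def by metis
qed

text \<open>A point \<open>z\<close> on a geodesic from \<open>x\<close> to \<open>y\<close> has
  \<open>D c x z \<le> D c x y\<close>, so the geodesic cannot drop below level
  \<open>k\<close>.\<close>

lemma conn_near:
  assumes "x \<in> V" "y \<in> V" "k + D c x y \<le> lev c x"
  shows "conn c k x y"
proof (rule conn_between[OF assms(1,2)])
  fix z assume z: "z \<in> V" "d x z + d z y = d x y"
  then have "D c x y = D c x z + D c z y" using D_add assms by blast
  moreover have "lev c x \<le> lev c z + D c z x" "D c z x = D c x z" using D_tri D_sym z assms base by blast+
  ultimately show "k \<le> lev c z" using assms by linarith
qed

text \<open>Apply \<open>tripod\<close> to the walk above level \<open>k\<close> and to geodesics
  from the base point to its ends. The point \<open>z\<close> found on the walk has level at least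
  \<open>k\<close>, so the nearby point on the geodesic to \<open>x\<close> has level at least
  \<open>k - B\<close> and is within \<open>B\<close> of \<open>x\<close>; likewise for
  \<open>y\<close>.\<close>

lemma level_diam:
  assumes "conn c k x y" "lev c x = k" "lev c y = k"
  shows "D c x y \<le> 6 * B"
proof -
  have xy: "x \<in> V" "y \<in> V" using assms(1) conn_in by auto
  obtain xs where xs: "chain adj x xs y" "\<forall>z\<in>insert x (set xs). z \<in> V \<and> k \<le> lev c z"
    using assms(1) unfolding conn_def by blast
  obtain ps qs where g: "geod b0 ps x" "geod b0 qs y" using geod_ex base xy by meson
  then obtain z p q where z: "z\<in>insert x (set xs)" "p\<in>insert b0 (set ps)" "q\<in>insert b0 (set qs)"
    "D c z p \<le> B" "D c z q \<le> B" using tripod[OF xs(1), of ps qs c] by (auto simp: geod_def)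
  have zV: "z \<in> V" "k \<le> lev c z" using xs z by auto
  have pV: "p \<in> V" "q \<in> V" using geod_between g z base by blast+
  have *: "D c w z \<le> 3 * B" if w: "geod b0 ws w" "u \<in> insert b0 (set ws)" "lev c w = k" "D c z u \<le> B" "w \<in> V"
    for u w ws
  proof -
    have u: "u \<in> V" "d b0 u + d u w = d b0 w" using geod_between[OF w(1,2) base] by auto
    then have "lev c w = lev c u + D c u w" using D_add base w by blast
    moreover have "lev c z \<le> lev c u + D c u z" "D c u z = D c z u" "D c u w = D c w u"
      "D c w z \<le> D c w u + D c u z"
      using D_tri D_sym base u zV w by blast+
    ultimately show ?thesis using w zV by linarith
  qed
  have "D c x z \<le> 3 * B" "D c y z \<le> 3 * B" using *[OF g(1) z(2)] *[OF g(2) z(3)] assms z xy by auto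
  moreover have "D c x y \<le> D c x z + D c z y" "D c z y = D c y z" using D_tri D_sym xy zV by blast+
  ultimately show ?thesis by linarith
qed

text \<open>Along a geodesic from \<open>x\<close> back to the base point the level drops by at most
  1 per step. The first point of level \<open>k\<close> is joined to \<open>x\<close> above that
  level, and additivity of \<open>D c\<close> gives its exact distance.\<close>

lemma level_point:
  assumes "x \<in> V" "k \<le> lev c x"
  obtains y where "y \<in> V" "conn c k x y" "lev c y = k" "D c x y = lev c x - k"
proof -
  have "\<exists>y\<in>V. lev c y = k \<and> conn c k x y \<and> d b0 y + d y x = d b0 x"
    using assms
  proof (induction "d b0 x" arbitrary: x)
    case 0
    then have "x = b0" using d_zero base by metis
    with 0 base show ?case by (auto intro!: bexI[of _ b0] simp: D_refl d_refl intro: conn_refl)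
  next
    case (Suc n)
    show ?case
    proof (cases "lev c x = k")
      case True
      with Suc show ?thesis by (auto simp: d_refl intro: conn_refl)
    next
      case False
      have "x \<noteq> b0" using Suc by (metis d_zero base nat.distinct(1))
      then obtain z where z: "z \<in> V" "d x z = 1" "d x b0 = Suc (d z b0)" using d_step[OF Suc.prems(1) base] by auto
      then have z': "adj z x" "d b0 z + d z x = d b0 x" "n = d b0 z" using Suc base d_sym by (auto simp: adj_def)
      then have "lev c x = lev c z + D c z x" using D_add base z Suc.prems by blast
      then have l: "k \<le> lev c z" using D_adj[OF z'(1), of c] False Suc.prems by (auto split: if_splits)
      then obtain y where y: "y \<in> V" "lev c y = k" "conn c k z y" "d b0 y + d y z = d b0 z"
        using Suc.hyps(1)[of z] z z' by blast
      have "conn c k x z" using l Suc.prems z adj_sym[OF z'(1)] unfolding conn_def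
        by (intro exI[of _ "[z]"]) auto
      then have "conn c k x y" using y conn_trans by blast
      moreover have "d b0 y + d y x = d b0 x"
        using d_tri[of b0 y x] d_tri[of y z x] y z z' base Suc.prems by linarith
      ultimately show ?thesis using y by blast
    qed
  qed
  then obtain y where y: "y \<in> V" "lev c y = k" "conn c k x y" "d b0 y + d y x = d b0 x" by blast
  then have "lev c x = lev c y + D c y x" using D_add base assms by blast
  then have "D c x y = lev c x - k" using y D_sym assms by simp
  with y that show thesis by blast
qed

text \<open>The choice sees \<open>x\<close> only through \<open>conn c k x\<close>, so all points
  of a component share their representative.\<close>

definition rep :: "'c \<Rightarrow> nat \<Rightarrow> 'a \<Rightarrow> 'a" where
  "rep c k x = (SOME y. conn c k x y \<and> lev c y = k)"

lemma rep:
  assumes "x \<in> V" "k \<le> lev c x"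
  shows "conn c k x (rep c k x)" "lev c (rep c k x) = k" "rep c k x \<in> V"
proof -
  have "\<exists>y. conn c k x y \<and> lev c y = k" using level_point[OF assms] by metis
  then show "conn c k x (rep c k x)" "lev c (rep c k x) = k"
    unfolding rep_def by (metis (mono_tags, lifting) someI_ex)+
  then show "rep c k x \<in> V" using conn_in by blast
qed

lemma rep_cong: "conn c k x y \<Longrightarrow> rep c k x = rep c k y"
  unfolding rep_def by (drule conn_eq) simp

lemma rep_near: "x \<in> V \<Longrightarrow> D c x (rep c (lev c x) x) \<le> 6 * B"
  using rep[of x "lev c x" c] by (intro level_diam[of c "lev c x"]) auto

lemma rep_step:
  assumes "x \<in> V" "lev c x = Suc k"
  shows "D c x (rep c k x) \<le> 6 * B + 1"
proof -
  obtain y where y: "y \<in> V" "conn c k x y" "lev c y = k" "D c x y = 1"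
    using level_point[of x k c] assms by auto
  have r: "conn c k x (rep c k x)" "lev c (rep c k x) = k" "rep c k x \<in> V" using rep[of x k c] assms by auto
  then have "D c y (rep c k x) \<le> 6 * B" using y conn_sym conn_trans by (intro level_diam) blast+
  moreover have "D c x (rep c k x) \<le> D c x y + D c y (rep c k x)" using D_tri assms y r by blast
  ultimately show ?thesis using y by linarith
qed

text \<open>The cut \<open>(c, 0, _)\<close> is a class of points at \<open>D c\<close>-distance zero, a leaf of the layering tree.\<close>

definition cut :: "'c \<Rightarrow> nat \<Rightarrow> 'a \<Rightarrow> 'a set" where
  "cut c k x = (if k = 0 then {y\<in>V. D c x y = 0} else {y. conn c k x y})"

text \<open>The path from the leaf of \<open>x\<close> towards the root. Points of level 0 get no
  cut, not even the leaf, so that the base point has none and every point has cuts in finitely many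
  colours only.\<close>

definition cuts :: "'c \<Rightarrow> 'a \<Rightarrow> ('c \<times> nat \<times> 'a set) set" where
  "cuts c x = (if lev c x = 0 then {} else (\<lambda>k. (c, k, cut c k x)) ` {..lev c x})"

lemma finite_cuts: "finite (cuts c x)"
  by (simp add: cuts_def)

lemma cuts_colour: "i \<in> cuts c x \<Longrightarrow> fst i = c"
  by (auto simp: cuts_def split: if_splits)

lemma card_cuts: "lev c x \<le> card (cuts c x)"
  unfolding cuts_def by (simp, subst card_image) (auto intro: inj_onI)

lemma cut_cong: "conn c k x y \<Longrightarrow> k \<noteq> 0 \<Longrightarrow> cut c k x = cut c k y"
  by (drule conn_eq) (simp add: cut_def)

lemma cut_0_cong:
  assumes "x \<in> V" "y \<in> V" "D c x y = 0"
  shows "cut c 0 x = cut c 0 y"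
proof -
  have "D c x z = 0 \<longleftrightarrow> D c y z = 0" if "z \<in> V" for z
    using D_tri[of x z y c] D_tri[of y z x c] D_sym[of x y c] assms that by auto
  then show ?thesis by (auto simp: cut_def)
qed

lemma lev_lipschitz: "x \<in> V \<Longrightarrow> y \<in> V \<Longrightarrow> lev c x \<le> lev c y + D c x y"
  using D_tri[of b0 x y c] D_sym[of x y c] base by simp

lemma cuts_cong:
  assumes "x \<in> V" "y \<in> V" "D c x y = 0"
  shows "cuts c x = cuts c y"
proof -
  have l: "lev c x = lev c y" using lev_lipschitz[of x y c] lev_lipschitz[of y x c] D_sym[of x y c] assms by simp
  have "cut c k x = cut c k y" if "k \<le> lev c x" for k
    using cut_0_cong[of x y c] cut_cong[of c k x y] conn_near[of x y k c] assms that by (cases "k = 0") auto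
  with l show ?thesis by (simp add: cuts_def)
qed

text \<open>By \<open>conn_near\<close> both points share all cuts of positive level up to
  \<open>lev c x - D c x y\<close>. At most \<open>D c x y\<close> higher levels and the leaf
  remain.\<close>

lemma cuts_lipschitz:
  assumes xy: "x \<in> V" "y \<in> V"
  shows "card (cuts c x - cuts c y) \<le> 2 * D c x y"
proof (cases "D c x y = 0")
  case True
  with cuts_cong[OF assms this] show ?thesis by simp
next
  case False
  let ?m = "lev c x - D c x y"
  have "cuts c x - cuts c y \<subseteq> (\<lambda>k. (c, k, cut c k x)) ` insert 0 {?m<..lev c x}"
  proof
    fix i assume i: "i \<in> cuts c x - cuts c y"
    then obtain k where k: "i = (c, k, cut c k x)" "k \<le> lev c x" "lev c x \<noteq> 0"
      by (auto simp: cuts_def split: if_splits)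
    have "?m < k" if "k \<noteq> 0"
    proof (rule ccontr)
      assume "\<not> ?m < k"
      with that have c: "conn c k x y" using xy by (intro conn_near) auto
      then have "k \<le> lev c y" using conn_in by blast
      then have "i \<in> cuts c y" using k cut_cong[OF c] that by (auto simp: cuts_def)
      with i show False by blast
    qed
    with k show "i \<in> (\<lambda>k. (c, k, cut c k x)) ` insert 0 {?m<..lev c x}" by (cases "k = 0") auto
  qed
  then have "card (cuts c x - cuts c y) \<le> card ((\<lambda>k. (c, k, cut c k x)) ` insert 0 {?m<..lev c x})"
    by (intro card_mono) auto
  also have "\<dots> \<le> card (insert 0 {?m<..lev c x})" by (intro card_image_le) auto
  also have "\<dots> \<le> Suc (lev c x - ?m)" using card_insert_le_m1[of "Suc (lev c x - ?m)" "{?m<..lev c x}" 0] by simp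
  \<comment> \<open>The leaf costs 1, which a second copy of the positive number
    \<open>D c x y\<close> absorbs.\<close>
  also have "\<dots> \<le> 2 * D c x y" using False by linarith
  finally show ?thesis .
qed

end

section \<open>The cuts of all colours and their ends in the layering tree\<close>

context layered_graph_metric begin

definition all_cuts :: "'a \<Rightarrow> ('c \<times> nat \<times> 'a set) set" where
  "all_cuts x = (\<Union>c. cuts c x)"

lemma in_all_cuts: "i \<in> all_cuts x \<longleftrightarrow> i \<in> cuts (fst i) x"
  using cuts_colour[of i _ x] by (auto simp: all_cuts_def)

lemma all_cuts_base: "all_cuts b0 = {}"
  by (auto simp: all_cuts_def cuts_def D_refl base)

text \<open>The levels of \<open>x\<close> over all colours add up to \<open>d b0 x\<close>. The
  lower bound later turns properness of the given action into properness of the cocycle.\<close>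

lemma all_cuts_finite_card:
  assumes "x \<in> V"
  shows "finite (all_cuts x)" "d b0 x \<le> card (all_cuts x)"
proof -
  obtain C where C: "finite C" "\<And>c. c \<notin> C \<Longrightarrow> D c b0 x = 0" "(\<Sum>c\<in>C. D c b0 x) = d b0 x"
    using D_sum base assms by metis
  have eq: "all_cuts x = (\<Union>c\<in>C. cuts c x)"
  proof -
    have "cuts c x = {}" if "c \<notin> C" for c using C(2)[OF that] by (simp add: cuts_def)
    then show ?thesis unfolding all_cuts_def by blast
  qed
  with C finite_cuts show "finite (all_cuts x)" by simp
  have "card (all_cuts x) = (\<Sum>c\<in>C. card (cuts c x))"
    unfolding eq using C(1) by (intro card_UN_disjoint) (auto simp: finite_cuts dest!: cuts_colour)
  also have "\<dots> \<ge> (\<Sum>c\<in>C. D c b0 x)" by (intro sum_mono card_cuts)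
  finally show "d b0 x \<le> card (all_cuts x)" using C by simp
qed

text \<open>The point is chosen from the set stored in the cut, so it depends on the cut alone and
  not on the point whose path contains it.\<close>

definition upper_end :: "'c \<times> nat \<times> 'a set \<Rightarrow> 'a" where
  "upper_end j = (let c = fst j; k = fst (snd j); S = snd (snd j) in
     if k = 0 then SOME y. y \<in> S else SOME y. y \<in> S \<and> lev c y = k)"

text \<open>The representative of the parent: a leaf hangs on the component at its own level, a
  component on the one a level below.\<close>

definition lower_end :: "'c \<times> nat \<times> 'a set \<Rightarrow> 'a" where
  "lower_end j = (let c = fst j; k = fst (snd j); p = upper_end j in
     rep c (if k = 0 then lev c p else k - 1) p)"

lemma upper_end_Suc: "k \<noteq> 0 \<Longrightarrow> upper_end (c, k, cut c k x) = rep c k x"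
  by (simp add: upper_end_def cut_def rep_def)

lemma upper_end_0:
  assumes "x \<in> V"
  shows "upper_end (c, 0, cut c 0 x) \<in> V" "D c x (upper_end (c, 0, cut c 0 x)) = 0"
proof -
  have "x \<in> cut c 0 x" using assms by (simp add: cut_def D_refl)
  then have "upper_end (c, 0, cut c 0 x) \<in> cut c 0 x" by (auto simp: upper_end_def intro: someI)
  then show "upper_end (c, 0, cut c 0 x) \<in> V" "D c x (upper_end (c, 0, cut c 0 x)) = 0"
    by (auto simp: cut_def)
qed

lemma lower_end_0:
  assumes "x \<in> V"
  shows "lower_end (c, 0, cut c 0 x) = rep c (lev c x) x"
proof -
  let ?y = "upper_end (c, 0, cut c 0 x)"
  note y = upper_end_0[OF assms, of c]
  have "lev c ?y = lev c x"
    using lev_lipschitz[OF y(1) assms, of c] lev_lipschitz[OF assms y(1), of c] D_sym[OF y(1) assms, of c] y by simp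
  moreover have "conn c (lev c x) x ?y" using y assms by (intro conn_near) auto
  ultimately show ?thesis using rep_cong[of c "lev c x" x ?y] by (simp add: lower_end_def)
qed

lemma lower_end_Suc:
  assumes "x \<in> V" "Suc k \<le> lev c x"
  shows "lower_end (c, Suc k, cut c (Suc k) x) = rep c k x"
proof -
  have "conn c k x (rep c (Suc k) x)" using conn_mono[OF rep(1)[OF assms], of k] by simp
  then show ?thesis using rep_cong[of c k x "rep c (Suc k) x"] by (simp add: lower_end_def upper_end_Suc)
qed

lemma ends_near:
  assumes "x \<in> V" "j \<in> cuts c x"
  shows "upper_end j \<in> V" "lower_end j \<in> V" "D c (upper_end j) (lower_end j) \<le> 6 * B + 1"
proof -
  obtain k where j: "j = (c, k, cut c k x)" "k \<le> lev c x"
    using assms by (auto simp: cuts_def split: if_splits)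
  have "upper_end j \<in> V \<and> lower_end j \<in> V \<and> D c (upper_end j) (lower_end j) \<le> 6 * B + 1"
  proof (cases k)
    case 0
    let ?y = "upper_end (c, 0, cut c 0 x)"
    let ?r = "rep c (lev c x) x"
    note y = upper_end_0[OF assms(1), of c]
    have r: "?r \<in> V" using rep(3)[OF assms(1) order_refl] .
    have "D c ?y ?r \<le> D c ?y x + D c x ?r" using D_tri[OF y(1) r assms(1)] .
    then have "D c ?y ?r \<le> 6 * B" using rep_near[OF assms(1), of c] y D_sym[OF y(1) assms(1), of c] by linarith
    with 0 j y r show ?thesis by (simp add: lower_end_0[OF assms(1)])
  next
    case (Suc l)
    let ?p = "rep c (Suc l) x"
    have l: "Suc l \<le> lev c x" using j Suc by simp
    note p = rep[OF assms(1) l]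
    have "rep c l x = rep c l ?p" using conn_mono[OF p(1), of l] by (intro rep_cong) simp
    then have "lower_end j = rep c l ?p" using lower_end_Suc[OF assms(1) l] j(1) Suc by simp
    moreover have "upper_end j = ?p" using j(1) Suc by (simp add: upper_end_Suc)
    moreover have "rep c l ?p \<in> V" using rep(3)[OF p(3), of l c] p(2) by simp
    ultimately show ?thesis using rep_step[OF p(3,2)] p(3) by simp
  qed
  then show "upper_end j \<in> V" "lower_end j \<in> V" "D c (upper_end j) (lower_end j) \<le> 6 * B + 1" by auto
qed

end

section \<open>The operator of an isometry that permutes the colours\<close>

locale layered_isometry = layered_graph_metric V d col b0 B
  for V :: "'a set" and d and col :: "'a \<Rightarrow> 'a \<Rightarrow> 'c" and b0 B +
  fixes \<phi> :: "'a \<Rightarrow> 'a" and \<gamma> :: "'c \<Rightarrow> 'c" and Cs :: "'c set"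
  assumes \<phi>_in: "x \<in> V \<Longrightarrow> \<phi> x \<in> V"
    and \<phi>_dist: "x \<in> V \<Longrightarrow> y \<in> V \<Longrightarrow> d (\<phi> x) (\<phi> y) = d x y"
    and col_in: "adj u v \<Longrightarrow> col u v \<in> Cs"
    and col_\<phi>: "adj u v \<Longrightarrow> col (\<phi> u) (\<phi> v) = \<gamma> (col u v)"
    and \<gamma>_inj: "inj_on \<gamma> Cs"
begin

lemma adj_\<phi>: "adj u v \<Longrightarrow> adj (\<phi> u) (\<phi> v)"
  by (auto simp: adj_def \<phi>_in \<phi>_dist)

lemma geod_\<phi>: "geod x P y \<Longrightarrow> x \<in> V \<Longrightarrow> geod (\<phi> x) (map \<phi> P) (\<phi> y)"
  unfolding geod_def using chain_map[of adj x P y adj \<phi>] adj_\<phi> chain_adj_end[of x P y] \<phi>_dist by simp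

text \<open>Edge colours lie in \<open>Cs\<close>, where \<open>\<gamma>\<close> is injective, so on
  a translated geodesic the edges of colour \<open>\<gamma> c\<close> are exactly the translates of
  those of colour \<open>c\<close>.\<close>

lemma D_\<phi>:
  assumes "x \<in> V" "y \<in> V" "c \<in> Cs"
  shows "D (\<gamma> c) (\<phi> x) (\<phi> y) = D c x y"
proof -
  obtain P where P: "geod x P y" using geod_ex assms by blast
  have "cnt (\<gamma> c) (\<phi> x) (map \<phi> P) = cnt c x P" if "chain adj x P y" for x
    using that
  proof (induction P arbitrary: x)
    case (Cons z P)
    then have "col (\<phi> x) (\<phi> z) = \<gamma> c \<longleftrightarrow> col x z = c"
      using col_\<phi>[of x z] col_in[of x z] \<gamma>_inj assms(3) by (auto dest: inj_onD)
    with Cons show ?case by simp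
  qed simp
  with P geod_\<phi>[OF P] assms \<phi>_in show ?thesis by (simp add: D_geod) (simp add: geod_def)
qed

lemma D_\<phi>_outside:
  assumes "x \<in> V" "y \<in> V" "c \<notin> \<gamma> ` Cs"
  shows "D c (\<phi> x) (\<phi> y) = 0"
proof -
  obtain P where P: "geod x P y" using geod_ex assms by blast
  have "cnt c (\<phi> x) (map \<phi> P) = 0" if "chain adj x P y" for x
    using that
  proof (induction P arbitrary: x)
    case (Cons z P)
    then have "col (\<phi> x) (\<phi> z) \<noteq> c"
      using col_\<phi>[of x z] col_in[of x z] assms(3) by auto
    with Cons show ?case by simp
  qed simp
  with P geod_\<phi>[OF P] assms \<phi>_in show ?thesis by (simp add: D_geod) (simp add: geod_def)
qed

lemma lev_outside:
  assumes "x \<in> V" "c \<notin> Cs"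
  shows "lev c x = 0"
proof -
  obtain P where P: "geod b0 P x" using geod_ex base assms by blast
  have "cnt c u P = 0" if "chain adj u P x" for u
    using that by (induction P arbitrary: u) (use assms(2) col_in in auto)
  with P base show ?thesis by (simp add: D_geod) (simp add: geod_def)
qed

definition ind :: "'c \<times> nat \<times> 'a set \<Rightarrow> 'a \<Rightarrow> real" where
  "ind i x = of_bool (i \<in> all_cuts x)"

text \<open>Row \<open>j\<close> is the image of the unit vector at \<open>j\<close>. Only
  coordinates of colour \<open>\<gamma> (fst j)\<close> are kept, because \<open>ends_near\<close>
  controls the ends of \<open>j\<close> in the pseudometric of that one colour
  \<open>fst j\<close>.\<close>

definition kern :: "'c \<times> nat \<times> 'a set \<Rightarrow> 'c \<times> nat \<times> 'a set \<Rightarrow> real" where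
  "kern j i = (if fst i = \<gamma> (fst j) then ind i (\<phi> (upper_end j)) - ind i (\<phi> (lower_end j)) else 0)"

text \<open>The row has entries -1, 0, 1 and lives on the symmetric difference of the cuts of one
  colour at the two translated ends; \<open>cuts_lipschitz\<close> bounds each half by
  \<open>2 * (6 * B + 1)\<close>.\<close>

lemma kern_norm:
  assumes "x \<in> V" "j \<in> all_cuts x"
  shows "\<exists>U. finite U \<and> U \<subseteq> (\<Union>x\<in>V. all_cuts x) \<and> (\<forall>i. i \<notin> U \<longrightarrow> kern j i = 0) \<and>
    (\<Sum>i\<in>U. \<bar>kern j i\<bar>) \<le> 4 * real (6 * B + 1)"
proof -
  let ?c = "fst j"
  have j: "j \<in> cuts ?c x" using assms in_all_cuts by blast
  note e = ends_near[OF assms(1) j]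
  have c: "?c \<in> Cs" using lev_outside[OF assms(1), of ?c] j by (auto simp: cuts_def split: if_splits)
  let ?p = "\<phi> (upper_end j)" and ?q = "\<phi> (lower_end j)"
  have pq: "?p \<in> V" "?q \<in> V" using e \<phi>_in by auto
  let ?P = "cuts (\<gamma> ?c) ?p" and ?Q = "cuts (\<gamma> ?c) ?q"
  let ?U = "(?P - ?Q) \<union> (?Q - ?P)"
  have DD: "D (\<gamma> ?c) ?p ?q \<le> 6 * B + 1" using D_\<phi>[OF e(1,2) c] e by simp
  have "?U \<subseteq> all_cuts ?p \<union> all_cuts ?q" unfolding all_cuts_def by blast
  then have sub: "?U \<subseteq> (\<Union>x\<in>V. all_cuts x)" using pq by blast
  have k: "kern j i = of_bool (i \<in> ?P) - of_bool (i \<in> ?Q)" for i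
    using cuts_colour[of i "\<gamma> ?c"] by (auto simp: kern_def ind_def in_all_cuts)
  have arith: "u \<le> 4 * e" if "u \<le> p + q" "p \<le> 2 * m" "q \<le> 2 * m'" "m \<le> e" "m = m'" for u p q m m' e :: nat
    using that by linarith
  have card: "card ?U \<le> 4 * (6 * B + 1)"
    by (rule arith[OF card_Un_le cuts_lipschitz[OF pq] cuts_lipschitz[OF pq(2,1)] DD D_sym[OF pq]])
  have "(\<Sum>i\<in>?U. \<bar>kern j i\<bar>) = (\<Sum>i\<in>?U. 1)" by (rule sum.cong) (auto simp: k)
  then have "(\<Sum>i\<in>?U. \<bar>kern j i\<bar>) = real (card ?U)" by simp
  also have "\<dots> \<le> real (4 * (6 * B + 1))" using card by (simp only: of_nat_le_iff)
  finally have bound: "(\<Sum>i\<in>?U. \<bar>kern j i\<bar>) \<le> 4 * real (6 * B + 1)" by simp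
  have "kern j i = 0" if "i \<notin> ?U" for i using that unfolding k by auto
  moreover have "finite ?U" by (simp add: finite_cuts)
  ultimately show ?thesis using bound sub by blast
qed

text \<open>A telescoping sum along the path of \<open>x\<close> in the layering tree: for a fixed
  coordinate \<open>i\<close> only the cuts of the one colour that \<open>\<gamma>\<close> sends to
  \<open>fst i\<close> contribute.\<close>

lemma kern_sum:
  assumes x: "x \<in> V"
  shows "(\<Sum>j\<in>all_cuts x. kern j i) = ind i (\<phi> x) - ind i (\<phi> b0)"
proof (cases "fst i \<in> \<gamma> ` Cs")
  case False
  have "kern j i = 0" if "j \<in> all_cuts x" for j
  proof -
    have "j \<in> cuts (fst j) x" using that in_all_cuts by blast
    then have "fst j \<in> Cs" using lev_outside[OF x, of "fst j"] by (auto simp: cuts_def split: if_splits)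
    with False show ?thesis by (auto simp: kern_def)
  qed
  \<comment> \<open>No translated edge has the colour of \<open>i\<close>, so the two translated
    points are at distance 0 in it.\<close>
  moreover have "cuts (fst i) (\<phi> x) = cuts (fst i) (\<phi> b0)"
    using D_\<phi>_outside[OF x base False] x base \<phi>_in by (intro cuts_cong)
  ultimately show ?thesis by (simp add: ind_def in_all_cuts)
next
  case True
  then obtain c where c: "c \<in> Cs" "fst i = \<gamma> c" by blast
  \<comment> \<open>Allows the upper end of the leaf to be replaced by \<open>x\<close> and the
    representative at level 0 by \<open>b0\<close>.\<close>
  have I: "ind i (\<phi> y) = ind i (\<phi> z)" if "y \<in> V" "z \<in> V" "D c y z = 0" for y z
    using cuts_cong[of "\<phi> y" "\<phi> z" "\<gamma> c"] D_\<phi>[of y z c] that c \<phi>_in by (simp add: ind_def in_all_cuts)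
  have k: "kern j i = (if fst j = c then ind i (\<phi> (upper_end j)) - ind i (\<phi> (lower_end j)) else 0)"
    if "j \<in> all_cuts x" for j
  proof -
    have "j \<in> cuts (fst j) x" using that in_all_cuts by blast
    then have "fst j \<in> Cs" using lev_outside[OF x, of "fst j"] by (auto simp: cuts_def split: if_splits)
    then have "\<gamma> (fst j) = \<gamma> c \<longleftrightarrow> fst j = c" using \<gamma>_inj c by (auto dest: inj_onD)
    with c show ?thesis by (auto simp: kern_def)
  qed
  have "(\<Sum>j\<in>all_cuts x. kern j i) = (\<Sum>j\<in>cuts c x. kern j i)"
    using all_cuts_finite_card[OF x] by (intro sum.mono_neutral_right) (auto simp: all_cuts_def k dest: cuts_colour)
  also have "\<dots> = (\<Sum>j\<in>cuts c x. ind i (\<phi> (upper_end j)) - ind i (\<phi> (lower_end j)))"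
  proof (rule sum.cong[OF refl])
    fix j assume "j \<in> cuts c x"
    then have "j \<in> all_cuts x" "fst j = c" using cuts_colour by (auto simp: all_cuts_def)
    then show "kern j i = ind i (\<phi> (upper_end j)) - ind i (\<phi> (lower_end j))" by (simp add: k)
  qed
  also have "\<dots> = ind i (\<phi> x) - ind i (\<phi> b0)"
  proof (cases "lev c x = 0")
    case True
    then show ?thesis using I[OF base x] by (simp add: cuts_def)
  next
    case False
    let ?n = "lev c x"
    let ?f = "\<lambda>k. ind i (\<phi> (rep c k x))"
    let ?j = "\<lambda>k. (c, k, cut c k x)"
    have "(\<Sum>j\<in>cuts c x. ind i (\<phi> (upper_end j)) - ind i (\<phi> (lower_end j)))
      = (\<Sum>k\<le>?n. ind i (\<phi> (upper_end (?j k))) - ind i (\<phi> (lower_end (?j k))))"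
    proof -
      have "inj_on ?j {..?n}" by (auto intro: inj_onI)
      moreover have "cuts c x = ?j ` {..?n}" using False by (simp add: cuts_def)
      ultimately show ?thesis by (simp only: sum.reindex o_def)
    qed
    \<comment> \<open>The leaf term is split off; the shift pairs level \<open>Suc k\<close> with
      its parent level \<open>k\<close>.\<close>
    also have "\<dots> = (ind i (\<phi> (upper_end (?j 0))) - ?f ?n) + (\<Sum>k<?n. ?f (Suc k) - ?f k)"
      unfolding lessThan_Suc_atMost[symmetric] sum.lessThan_Suc_shift
      by (simp add: lower_end_0[OF x] lower_end_Suc[OF x] upper_end_Suc)
    also have "(\<Sum>k<?n. ?f (Suc k) - ?f k) = ?f ?n - ?f 0" by (rule sum_lessThan_telescope)
    also have "?f 0 = ind i (\<phi> b0)" using rep[OF x, of 0 c] base by (intro I[symmetric]) auto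
    also have "ind i (\<phi> (upper_end (?j 0))) = ind i (\<phi> x)"
      using upper_end_0[OF x, of c] x by (intro I[symmetric])
    finally show ?thesis by simp
  qed
  finally show ?thesis .
qed

end

section \<open>Affine actions on subspaces of \<open>L\<^sup>1\<close> from operator cocycles\<close>

text \<open>\<open>T\<close> acts on functions rather than classes and is linear up to null sets.
  Compatibility with the group law enters through its effect on \<open>b\<close>, in
  \<open>b_mult\<close>.\<close>

locale L1_cocycle = group \<Gamma> for \<Gamma> :: "('g, 'm) monoid_scheme" (structure) +
  fixes M :: "'a measure" and T :: "'g \<Rightarrow> ('a \<Rightarrow> real) \<Rightarrow> 'a \<Rightarrow> real" and b :: "'g \<Rightarrow> 'a \<Rightarrow> real" and K :: real
  assumes T_int: "g \<in> carrier \<Gamma> \<Longrightarrow> integrable M v \<Longrightarrow> integrable M (T g v)"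
    and T_add: "g \<in> carrier \<Gamma> \<Longrightarrow> integrable M v \<Longrightarrow> integrable M w \<Longrightarrow>
      AE x in M. T g (\<lambda>x. v x + w x) x = T g v x + T g w x"
    and T_scale: "g \<in> carrier \<Gamma> \<Longrightarrow> integrable M v \<Longrightarrow> AE x in M. T g (\<lambda>x. c * v x) x = c * T g v x"
    and T_bound: "g \<in> carrier \<Gamma> \<Longrightarrow> integrable M v \<Longrightarrow> (\<integral>x. \<bar>T g v x\<bar> \<partial>M) \<le> K * (\<integral>x. \<bar>v x\<bar> \<partial>M)"
    and K_ge: "1 \<le> K"
    and b_int: "g \<in> carrier \<Gamma> \<Longrightarrow> integrable M (b g)"
    and b_mult: "g \<in> carrier \<Gamma> \<Longrightarrow> h \<in> carrier \<Gamma> \<Longrightarrow> AE x in M. b (g \<otimes> h) x = T g (b h) x + b g x"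
    and b_one: "AE x in M. b \<one> x = 0"
    and b_proper: "finite {g \<in> carrier \<Gamma>. (\<integral>x. \<bar>b g x\<bar> \<partial>M) \<le> R}"
begin

abbreviation cl :: "('a \<Rightarrow> real) \<Rightarrow> ('a \<Rightarrow> real) set" where "cl \<equiv> L1_class M"

lemma cl_in [simp]: "integrable M f \<Longrightarrow> cl f \<in> vecs (L1 M)"
  by (auto simp: L1_def)

lemma T_diff:
  assumes "g \<in> carrier \<Gamma>" "integrable M v" "integrable M w"
  shows "AE x in M. T g (\<lambda>x. v x - w x) x = T g v x - T g w x"
proof -
  have "AE x in M. T g (\<lambda>x. v x + (-1) * w x) x = T g v x + T g (\<lambda>x. (-1) * w x) x"
    using assms by (intro T_add) auto
  moreover have "AE x in M. T g (\<lambda>x. (-1) * w x) x = (-1) * T g w x"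
    using assms by (intro T_scale)
  ultimately have "AE x in M. T g (\<lambda>x. v x + (-1) * w x) x = T g v x - T g w x"
    by eventually_elim simp
  then show ?thesis by simp
qed

lemma T_lipschitz:
  assumes "g \<in> carrier \<Gamma>" "integrable M v" "integrable M w"
  shows "(\<integral>x. \<bar>T g v x - T g w x\<bar> \<partial>M) \<le> K * (\<integral>x. \<bar>v x - w x\<bar> \<partial>M)"
proof -
  have "(\<integral>x. \<bar>T g v x - T g w x\<bar> \<partial>M) = (\<integral>x. \<bar>T g (\<lambda>x. v x - w x) x\<bar> \<partial>M)"
  proof (rule integral_cong_AE)
    show "AE x in M. \<bar>T g v x - T g w x\<bar> = \<bar>T g (\<lambda>x. v x - w x) x\<bar>"
      using T_diff[OF assms] by eventually_elim simp
  qed (use T_int[OF assms(1)] assms in auto)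
  also have "\<dots> \<le> K * (\<integral>x. \<bar>v x - w x\<bar> \<partial>M)" using assms by (intro T_bound) auto
  finally show ?thesis .
qed

text \<open>The bound applied to a difference that vanishes almost everywhere forces the images to
  agree almost everywhere; this makes \<open>Top\<close> well defined on classes.\<close>

lemma T_cong:
  assumes "g \<in> carrier \<Gamma>" "integrable M v" "integrable M w" "AE x in M. v x = w x"
  shows "AE x in M. T g v x = T g w x"
proof -
  have "(\<integral>x. \<bar>v x - w x\<bar> \<partial>M) = (\<integral>x. 0 \<partial>M)" using assms by (intro integral_cong_AE) auto
  then have "(\<integral>x. \<bar>T g v x - T g w x\<bar> \<partial>M) \<le> 0" using T_lipschitz[OF assms(1-3)] by simp
  moreover have "0 \<le> (\<integral>x. \<bar>T g v x - T g w x\<bar> \<partial>M)" by simp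
  ultimately have "(\<integral>x. \<bar>T g v x - T g w x\<bar> \<partial>M) = 0" by linarith
  moreover have "integrable M (\<lambda>x. \<bar>T g v x - T g w x\<bar>)" using assms T_int by auto
  ultimately have "AE x in M. \<bar>T g v x - T g w x\<bar> = 0"
    using integral_nonneg_eq_0_iff_AE[of M "\<lambda>x. \<bar>T g v x - T g w x\<bar>"] by simp
  then show ?thesis by simp
qed

definition Top :: "'g \<Rightarrow> ('a \<Rightarrow> real) set \<Rightarrow> ('a \<Rightarrow> real) set" where
  "Top g F = cl (T g (SOME f. f \<in> F))"

lemma Top:
  assumes "g \<in> carrier \<Gamma>" "integrable M f"
  shows "Top g (cl f) = cl (T g f)"
proof -
  have "(SOME h. h \<in> cl f) \<in> cl f" by (rule someI[where P = "\<lambda>h. h \<in> cl f", OF L1_class_self[OF assms(2)]])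
  then show ?thesis unfolding Top_def using assms by (intro L1_class_cong T_cong) (auto simp: L1_class_def)
qed

lemma Top_in: "g \<in> carrier \<Gamma> \<Longrightarrow> F \<in> vecs (L1 M) \<Longrightarrow> Top g F \<in> vecs (L1 M)"
  by (erule L1_vecsE) (simp add: Top T_int)

lemma vadd_in: "F \<in> vecs (L1 M) \<Longrightarrow> G \<in> vecs (L1 M) \<Longrightarrow> vadd (L1 M) F G \<in> vecs (L1 M)"
  by (elim L1_vecsE) (simp add: L1_vadd)

lemma vscale_in: "F \<in> vecs (L1 M) \<Longrightarrow> vscale (L1 M) c F \<in> vecs (L1 M)"
  by (elim L1_vecsE) (simp add: L1_vscale)

lemma Top_add:
  assumes "g \<in> carrier \<Gamma>" "F \<in> vecs (L1 M)" "G \<in> vecs (L1 M)"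
  shows "Top g (vadd (L1 M) F G) = vadd (L1 M) (Top g F) (Top g G)"
proof -
  obtain f h where fh: "integrable M f" "F = cl f" "integrable M h" "G = cl h"
    using assms by (metis L1_vecsE)
  then have "vadd (L1 M) (Top g F) (Top g G) = cl (\<lambda>x. T g f x + T g h x)"
    using assms by (simp add: Top L1_vadd T_int)
  also have "\<dots> = cl (T g (\<lambda>x. f x + h x))" using T_add[OF assms(1) fh(1,3)] by (intro L1_class_cong) auto
  finally show ?thesis using assms fh by (simp add: Top L1_vadd T_int)
qed

lemma Top_scale:
  assumes "g \<in> carrier \<Gamma>" "F \<in> vecs (L1 M)"
  shows "Top g (vscale (L1 M) c F) = vscale (L1 M) c (Top g F)"
proof -
  obtain f where fh: "integrable M f" "F = cl f"
    using assms by (metis L1_vecsE)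
  then have "vscale (L1 M) c (Top g F) = cl (\<lambda>x. c * T g f x)"
    using assms by (simp add: Top L1_vscale T_int)
  also have "\<dots> = cl (T g (\<lambda>x. c * f x))" using T_scale[OF assms(1) fh(1), of c]
    by (intro L1_class_cong, eventually_elim) simp
  finally show ?thesis using assms fh by (simp add: Top L1_vscale T_int)
qed

lemma Top_norm: "g \<in> carrier \<Gamma> \<Longrightarrow> F \<in> vecs (L1 M) \<Longrightarrow> vnorm (L1 M) (Top g F) \<le> K * vnorm (L1 M) F"
  by (elim L1_vecsE) (simp add: Top T_int L1_vnorm T_bound)

lemma Top_lipschitz:
  "g \<in> carrier \<Gamma> \<Longrightarrow> F \<in> vecs (L1 M) \<Longrightarrow> G \<in> vecs (L1 M) \<Longrightarrow>
    vdist (L1 M) (Top g F) (Top g G) \<le> K * vdist (L1 M) F G"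
  by (elim L1_vecsE) (simp add: Top T_int L1_vdist T_lipschitz)

text \<open>The operators need not compose like the group on all of \<open>L\<^sup>1\<close>; this is the largest subspace
  on which they do.\<close>

definition Sp :: "('a \<Rightarrow> real) set set" where
  "Sp = {F \<in> vecs (L1 M). Top \<one> F = F \<and>
     (\<forall>g\<in>carrier \<Gamma>. \<forall>h\<in>carrier \<Gamma>. Top g (Top h F) = Top (g \<otimes> h) F)}"

lemma Sp_sub: "F \<in> Sp \<Longrightarrow> F \<in> vecs (L1 M)"
  by (simp add: Sp_def)

text \<open>On \<open>Top g F\<close> both sides of the composition law reduce to the operator of a
  triple product applied to \<open>F\<close>.\<close>

lemma Top_Sp: "g \<in> carrier \<Gamma> \<Longrightarrow> F \<in> Sp \<Longrightarrow> Top g F \<in> Sp"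
  by (auto simp: Sp_def Top_in m_assoc)

lemma Top_comp: "g \<in> carrier \<Gamma> \<Longrightarrow> h \<in> carrier \<Gamma> \<Longrightarrow> F \<in> Sp \<Longrightarrow> Top g (Top h F) = Top (g \<otimes> h) F"
  by (simp add: Sp_def)

lemma Top_one: "F \<in> Sp \<Longrightarrow> Top \<one> F = F"
  by (simp add: Sp_def)

text \<open>\<open>Sp\<close> is the set where certain pairs of Lipschitz maps agree, hence closed;
  the constant \<open>K * K\<close> serves all of these maps.\<close>

lemma closed_Sp: "closed_subspace Sp (L1 M)"
proof -
  interpret L: Metric_space "vecs (L1 M)" "vdist (L1 M)" by (rule L1_Metric_space)
  have sep: "\<exists>r>0. disjnt Sp (L.mball F r)" if F: "F \<in> vecs (L1 M)" "F \<notin> Sp" for F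
  proof -
    \<comment> \<open>If \<open>P\<close> and \<open>Q\<close> differ by \<open>e\<close> at
      \<open>F\<close>, a point of \<open>Sp\<close> within \<open>e / (2 * K * K)\<close> of
      \<open>F\<close>, where they agree, would force the difference at \<open>F\<close> below
      \<open>e\<close>.\<close>
    have near: "\<exists>r>0. disjnt Sp (L.mball F r)"
      if P: "P F \<noteq> Q F" "\<And>G. G \<in> vecs (L1 M) \<Longrightarrow> P G \<in> vecs (L1 M) \<and> Q G \<in> vecs (L1 M)"
        "\<And>G. G \<in> Sp \<Longrightarrow> P G = Q G"
        "\<And>G. G \<in> vecs (L1 M) \<Longrightarrow> vdist (L1 M) (P F) (P G) \<le> K * K * vdist (L1 M) F G"
        "\<And>G. G \<in> vecs (L1 M) \<Longrightarrow> vdist (L1 M) (Q F) (Q G) \<le> K * K * vdist (L1 M) F G" for P Q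
    proof (intro exI conjI)
      let ?e = "vdist (L1 M) (P F) (Q F)"
      have e: "?e > 0" using P F L.mdist_pos_less by auto
      then show "0 < ?e / (2 * K * K)" using K_ge by simp
      show "disjnt Sp (L.mball F (?e / (2 * K * K)))"
      proof (rule ccontr)
        assume "\<not> disjnt Sp (L.mball F (?e / (2 * K * K)))"
        then obtain G where G: "G \<in> Sp" "vdist (L1 M) F G < ?e / (2 * K * K)" by (auto simp: disjnt_def)
        then have GV: "G \<in> vecs (L1 M)" by (simp add: Sp_sub)
        have "?e \<le> vdist (L1 M) (P F) (P G) + vdist (L1 M) (P G) (Q F)"
          using P F GV by (intro L.triangle) auto
        also have "vdist (L1 M) (P G) (Q F) = vdist (L1 M) (Q F) (Q G)"
          using P(3)[OF G(1)] L.commute by simp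
        also have "vdist (L1 M) (P F) (P G) + vdist (L1 M) (Q F) (Q G) \<le> 2 * (K * K * vdist (L1 M) F G)"
          using P(4,5)[OF GV] by linarith
        also have "\<dots> < ?e" using G(2) K_ge by (simp add: field_simps)
        finally show False by simp
      qed
    qed
    have lip: "vdist (L1 M) (Top g F) (Top g G) \<le> K * K * vdist (L1 M) F G"
      if "g \<in> carrier \<Gamma>" "F \<in> vecs (L1 M)" "G \<in> vecs (L1 M)" for F G g
    proof -
      have "vdist (L1 M) (Top g F) (Top g G) \<le> K * vdist (L1 M) F G" using that by (rule Top_lipschitz)
      also have "\<dots> \<le> K * (K * vdist (L1 M) F G)"
        using K_ge mult_right_mono[of 1 K "vdist (L1 M) F G"] by (intro mult_left_mono) auto
      finally show ?thesis by simp
    qed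
    have lip_id: "vdist (L1 M) F G \<le> K * K * vdist (L1 M) F G" for F G
    proof -
      have "1 * 1 \<le> K * K" using K_ge by (intro mult_mono) auto
      then show ?thesis using mult_right_mono[of 1 "K * K" "vdist (L1 M) F G"] by simp
    qed
    have lip_comp: "vdist (L1 M) (Top g (Top h F)) (Top g (Top h G)) \<le> K * K * vdist (L1 M) F G"
      if "g \<in> carrier \<Gamma>" "h \<in> carrier \<Gamma>" "F \<in> vecs (L1 M)" "G \<in> vecs (L1 M)" for F G g h
    proof -
      have "vdist (L1 M) (Top g (Top h F)) (Top g (Top h G)) \<le> K * vdist (L1 M) (Top h F) (Top h G)"
        using that by (intro Top_lipschitz Top_in)
      also have "\<dots> \<le> K * (K * vdist (L1 M) F G)"
        using that K_ge by (intro mult_left_mono Top_lipschitz) auto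
      finally show ?thesis by simp
    qed
    consider "Top \<one> F \<noteq> F" | g h where "g \<in> carrier \<Gamma>" "h \<in> carrier \<Gamma>" "Top g (Top h F) \<noteq> Top (g \<otimes> h) F"
      using F unfolding Sp_def by blast
    then show ?thesis
    proof cases
      case 1
      then show ?thesis using F lip lip_id by (intro near[of "Top \<one>" "\<lambda>G. G"]) (auto simp: Top_in Top_one)
    next
      case (2 g h)
      then show ?thesis using F lip lip_comp
        by (intro near[of "\<lambda>G. Top g (Top h G)" "\<lambda>G. Top (g \<otimes> h) G"]) (auto simp: Top_in Top_comp)
    qed
  qed
  have zero: "cl (\<lambda>x. 0) \<in> Sp"
  proof -
    have "Top g (cl (\<lambda>x. 0)) = cl (\<lambda>x. 0)" if "g \<in> carrier \<Gamma>" for g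
    proof -
      \<comment> \<open>The zero function is 0 times itself, so homogeneity shows that its image
        vanishes.\<close>
      have "AE x in M. T g (\<lambda>x. 0 * (0::real)) x = 0 * T g (\<lambda>x. 0) x"
        using that by (intro T_scale) auto
      then have "cl (T g (\<lambda>x. 0)) = cl (\<lambda>x. 0)" by (intro L1_class_cong) simp
      with that show ?thesis by (simp add: Top)
    qed
    then show ?thesis by (simp add: Sp_def)
  qed
  show ?thesis unfolding closed_subspace_def L.closedin_metric
  proof (intro conjI allI ballI impI)
    show "Sp \<noteq> {}" using zero by blast
    show "vadd (L1 M) v w \<in> Sp" if "v \<in> Sp" "w \<in> Sp" for v w
      using that by (auto simp: Sp_def vadd_in Top_add Top_in)
    show "vscale (L1 M) c v \<in> Sp" if "v \<in> Sp" for v c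
      using that by (auto simp: Sp_def vscale_in Top_scale Top_in)
  qed (use sep Sp_sub in auto)
qed

definition E :: "('a \<Rightarrow> real) set normed_sp" where "E = subspace_of (L1 M) Sp"

lemma E_simps [simp]: "vecs E = Sp" "vadd E = vadd (L1 M)" "vscale E = vscale (L1 M)" "vnorm E = vnorm (L1 M)"
  by (simp_all add: E_def subspace_of_def)

lemma vdist_E: "v \<in> Sp \<Longrightarrow> w \<in> Sp \<Longrightarrow> vdist E v w = vdist (L1 M) v w"
  by (simp add: vdist_def Sp_sub)

text \<open>The restriction makes the map extensional, as membership in \<open>Bij\<close>
  requires.\<close>

definition pr :: "'g \<Rightarrow> ('a \<Rightarrow> real) set \<Rightarrow> ('a \<Rightarrow> real) set" where "pr g = restrict (Top g) Sp"

lemma pr_hom: "pr \<in> hom \<Gamma> (GL E)"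
proof -
  have inv: "Top (inv g) (Top g F) = F" "Top g (Top (inv g) F) = F" if "g \<in> carrier \<Gamma>" "F \<in> Sp" for g F
    using that by (simp_all add: Top_comp Top_one)
  have bij: "bij_betw (Top g) Sp Sp" if "g \<in> carrier \<Gamma>" for g
    using that inv by (intro bij_betw_byWitness[where f' = "Top (inv g)"]) (auto simp: Top_Sp)
  have Bij: "pr g \<in> Bij Sp" if "g \<in> carrier \<Gamma>" for g
    using bij[OF that] by (simp add: Bij_def pr_def)
  have lin: "bounded_linear_op E (Top g)" if "g \<in> carrier \<Gamma>" for g
    using that unfolding bounded_linear_op_def
    by (auto simp: Top_Sp Top_add Top_scale Sp_sub intro!: exI[of _ K] Top_norm)
  \<comment> \<open>Boundedness and linearity concern values on the carrier only, so
    \<open>pr g\<close> and its \<open>inv_into\<close> may be replaced by \<open>Top g\<close> and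
    \<open>Top (inv g)\<close>.\<close>
  have cong: "bounded_linear_op E f \<longleftrightarrow> bounded_linear_op E f'" if "\<And>v. v \<in> Sp \<Longrightarrow> f v = f' v" for f f'
  proof -
    have "vadd (L1 M) v w \<in> Sp" "vscale (L1 M) c v \<in> Sp" if "v \<in> Sp" "w \<in> Sp" for v w c
      using closed_Sp that by (auto simp: closed_subspace_def)
    then show ?thesis unfolding bounded_linear_op_def using that by (simp add: Pi_def)
  qed
  have inv_eq: "inv_into Sp (pr g) F = Top (inv g) F" if "g \<in> carrier \<Gamma>" "F \<in> Sp" for g F
  proof -
    have "inj_on (pr g) Sp" using Bij[OF that(1)] by (simp add: Bij_def bij_betw_def)
    moreover have "pr g (Top (inv g) F) = F" using that inv by (simp add: pr_def Top_Sp)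
    ultimately show ?thesis using that by (intro inv_into_f_eq) (auto simp: Top_Sp)
  qed
  have "pr g \<in> carrier (GL E)" if "g \<in> carrier \<Gamma>" for g
    using that Bij[OF that] lin[OF that] lin[of "inv g"] cong[of "pr g" "Top g"]
      cong[of "inv_into Sp (pr g)" "Top (inv g)"] inv_eq
    by (simp add: GL_def pr_def)
  moreover have "pr (g \<otimes> h) = pr g \<otimes>\<^bsub>GL E\<^esub> pr h" if "g \<in> carrier \<Gamma>" "h \<in> carrier \<Gamma>" for g h
    using that Bij by (auto simp: GL_def BijGroup_def compose_def pr_def Top_Sp Top_comp fun_eq_iff)
  ultimately show ?thesis by (intro homI)
qed

lemma T_b: "g \<in> carrier \<Gamma> \<Longrightarrow> h \<in> carrier \<Gamma> \<Longrightarrow> AE x in M. T g (b h) x = b (g \<otimes> h) x - b g x"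
  using b_mult[of g h] by (rule AE_mp) auto

text \<open>By the cocycle identity \<open>T g\<close> sends \<open>b h\<close> to
  \<open>b (g \<otimes> h) - b g\<close>, so \<open>Top g\<close> after \<open>Top h\<close>, like
  \<open>Top (g \<otimes> h)\<close>, sends the class of \<open>b k\<close> to that of
  \<open>b (g \<otimes> h \<otimes> k) - b (g \<otimes> h)\<close>.\<close>

lemma b_Sp: "k \<in> carrier \<Gamma> \<Longrightarrow> cl (b k) \<in> Sp"
proof -
  assume k: "k \<in> carrier \<Gamma>"
  have Tb: "Top g (cl (b h)) = cl (\<lambda>x. b (g \<otimes> h) x - b g x)" if "g \<in> carrier \<Gamma>" "h \<in> carrier \<Gamma>" for g h
    using that T_b by (simp add: Top b_int L1_class_cong)
  have "Top g (Top h (cl (b k))) = Top (g \<otimes> h) (cl (b k))" if gh: "g \<in> carrier \<Gamma>" "h \<in> carrier \<Gamma>" for g h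
  proof -
    have "Top g (Top h (cl (b k))) = cl (T g (\<lambda>x. b (h \<otimes> k) x - b h x))"
      unfolding Tb[OF gh(2) k] using gh k by (intro Top) (auto intro!: b_int)
    also have "\<dots> = cl (\<lambda>x. b (g \<otimes> h \<otimes> k) x - b (g \<otimes> h) x)"
    proof (rule L1_class_cong)
      have "AE x in M. T g (\<lambda>x. b (h \<otimes> k) x - b h x) x = T g (b (h \<otimes> k)) x - T g (b h) x"
        using gh k by (intro T_diff b_int) auto
      moreover have "AE x in M. T g (b (h \<otimes> k)) x = b (g \<otimes> (h \<otimes> k)) x - b g x" using gh k by (intro T_b) auto
      moreover have "AE x in M. T g (b h) x = b (g \<otimes> h) x - b g x" using gh k by (intro T_b)
      ultimately show "AE x in M. T g (\<lambda>x. b (h \<otimes> k) x - b h x) x = b (g \<otimes> h \<otimes> k) x - b (g \<otimes> h) x"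
        by eventually_elim (use gh k in \<open>simp add: m_assoc\<close>)
    qed
    finally show ?thesis using gh k by (simp add: Tb)
  qed
  moreover have "Top \<one> (cl (b k)) = cl (b k)"
    using k b_one by (simp add: Tb) (rule L1_class_cong, simp)
  ultimately show ?thesis using k by (simp add: Sp_def b_int)
qed

lemma affine: "affine_action \<Gamma> E pr (\<lambda>g. cl (b g))"
  unfolding affine_action_def
proof (intro conjI ballI pr_hom)
  fix g h assume gh: "g \<in> carrier \<Gamma>" "h \<in> carrier \<Gamma>"
  have "vadd E (pr g (cl (b h))) (cl (b g)) = cl (\<lambda>x. T g (b h) x + b g x)"
    using gh by (simp add: pr_def b_Sp Top b_int L1_vadd T_int)
  also have "\<dots> = cl (b (g \<otimes> h))" using b_mult[OF gh] by (intro L1_class_cong) auto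
  finally show "cl (b (g \<otimes> h)) = vadd E (pr g (cl (b h))) (cl (b g))" ..
qed (simp add: b_Sp)

lemma affine_map_cl:
  assumes "g \<in> carrier \<Gamma>" "integrable M f" "cl f \<in> Sp"
  shows "affine_map E pr (\<lambda>g. cl (b g)) g (cl f) = cl (\<lambda>x. T g f x + b g x)"
    "cl (\<lambda>x. T g f x + b g x) \<in> Sp"
proof -
  show eq: "affine_map E pr (\<lambda>g. cl (b g)) g (cl f) = cl (\<lambda>x. T g f x + b g x)"
    using assms by (simp add: affine_map_def pr_def Top L1_vadd T_int b_int)
  have "Top g (cl f) \<in> Sp" using assms by (intro Top_Sp)
  then have "vadd (L1 M) (Top g (cl f)) (cl (b g)) \<in> Sp"
    using b_Sp[OF assms(1)] closed_Sp by (simp add: closed_subspace_def)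
  then show "cl (\<lambda>x. T g f x + b g x) \<in> Sp"
    using assms by (simp add: Top L1_vadd T_int b_int)
qed

lemma uniform: "uniformly_Lipschitz \<Gamma> E (affine_map E pr (\<lambda>g. cl (b g)))"
  unfolding uniformly_Lipschitz_def
proof (intro exI[of _ K] conjI ballI K_ge)
  fix g v w assume g: "g \<in> carrier \<Gamma>" and "v \<in> vecs E" "w \<in> vecs E"
  then obtain f h where fh: "integrable M f" "v = cl f" "integrable M h" "w = cl h" "cl f \<in> Sp" "cl h \<in> Sp"
    by (metis E_simps(1) Sp_sub L1_vecsE)
  then show "vdist E (affine_map E pr (\<lambda>g. cl (b g)) g v) (affine_map E pr (\<lambda>g. cl (b g)) g w) \<le> K * vdist E v w"
    using T_lipschitz[OF g fh(1,3)] g by (simp add: affine_map_cl vdist_E L1_vdist T_int b_int)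
qed

text \<open>The norm of \<open>b g\<close> is at most the displacement of \<open>v\<close> plus
  \<open>K + 1\<close> times the norm of \<open>v\<close>, so bounded displacement leaves finitely
  many \<open>g\<close> by \<open>b_proper\<close>.\<close>

lemma proper: "proper_action \<Gamma> (vecs E) (vdist E) (affine_map E pr (\<lambda>g. cl (b g)))"
  unfolding proper_action_def
proof (intro ballI allI impI)
  fix v R assume "v \<in> vecs E" "(0::real) < R"
  then obtain f where f: "integrable M f" "v = cl f" "cl f \<in> Sp"
    by (metis E_simps(1) Sp_sub L1_vecsE)
  let ?n = "\<integral>x. \<bar>f x\<bar> \<partial>M"
  have "(\<integral>x. \<bar>b g x\<bar> \<partial>M) \<le> vdist E (affine_map E pr (\<lambda>g. cl (b g)) g v) v + (K + 1) * ?n"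
    if g: "g \<in> carrier \<Gamma>" for g
  proof -
    have int: "integrable M (T g f)" "integrable M (b g)" using g f by (auto simp: T_int b_int)
    have "(\<integral>x. \<bar>b g x\<bar> \<partial>M) \<le> (\<integral>x. \<bar>T g f x + b g x - f x\<bar> + (\<bar>T g f x\<bar> + \<bar>f x\<bar>) \<partial>M)"
      using int f by (intro integral_mono) auto
    also have "\<dots> = (\<integral>x. \<bar>T g f x + b g x - f x\<bar> \<partial>M) + ((\<integral>x. \<bar>T g f x\<bar> \<partial>M) + ?n)"
      using int f by simp
    also have "(\<integral>x. \<bar>T g f x + b g x - f x\<bar> \<partial>M) = vdist E (affine_map E pr (\<lambda>g. cl (b g)) g v) v"
      using f g int affine_map_cl[OF g f(1,3)] by (simp add: vdist_E L1_vdist)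
    also have "(\<integral>x. \<bar>T g f x\<bar> \<partial>M) \<le> K * ?n" using g f by (intro T_bound)
    finally show ?thesis by (simp add: algebra_simps)
  qed
  then have "{g \<in> carrier \<Gamma>. vdist E (affine_map E pr (\<lambda>g. cl (b g)) g v) v \<le> R} \<subseteq>
    {g \<in> carrier \<Gamma>. (\<integral>x. \<bar>b g x\<bar> \<partial>M) \<le> R + (K + 1) * ?n}" by fastforce
  then show "finite {g \<in> carrier \<Gamma>. vdist E (affine_map E pr (\<lambda>g. cl (b g)) g v) v \<le> R}"
    using b_proper finite_subset by blast
qed

lemma L1_action:
  "\<exists>S E \<pi> b. closed_subspace S (L1 M) \<and> E = subspace_of (L1 M) S \<and> affine_action \<Gamma> E \<pi> b \<and>
    uniformly_Lipschitz \<Gamma> E (affine_map E \<pi> b) \<and> proper_action \<Gamma> (vecs E) (vdist E) (affine_map E \<pi> b)"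
  using closed_Sp E_def affine uniform proper by blast

end

section \<open>Operators on summable families given by kernels\<close>

no_notation Infinite_Sum.abs_summable_on (infixr \<open>abs'_summable'_on\<close> 46)

text \<open>\<open>a j\<close> is the image of the unit vector at \<open>j\<close>. Sums are taken
  with \<open>infsetsum\<close>, the integral for the counting measure, which ties them to
  \<open>L1\<close>.\<close>

definition kernel_op :: "'j set \<Rightarrow> ('j \<Rightarrow> 'j \<Rightarrow> real) \<Rightarrow> ('j \<Rightarrow> real) \<Rightarrow> 'j \<Rightarrow> real" where
  "kernel_op J a v i = infsetsum (\<lambda>j. v j * a j i) J"

context
  fixes J :: "'j set" and a :: "'j \<Rightarrow> 'j \<Rightarrow> real" and K :: real
  assumes J: "countable J"
    and a_summable: "j \<in> J \<Longrightarrow> a j abs_summable_on J"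
    and a_bound: "j \<in> J \<Longrightarrow> infsetsum (\<lambda>i. \<bar>a j i\<bar>) J \<le> K"
begin

text \<open>The inner absolute sums over \<open>i\<close> are at most
  \<open>K * \<bar>v j\<bar>\<close>, so the double family is summable by Tonelli; the later
  exchanges of sums rest on this.\<close>

lemma kernel_Times:
  assumes "v abs_summable_on J"
  shows "(\<lambda>(j, i). v j * a j i) abs_summable_on J \<times> J"
proof (subst abs_summable_on_Sigma_iff, use J in simp, use J in simp, intro conjI ballI)
  show "(\<lambda>i. case (j, i) of (j, i) \<Rightarrow> v j * a j i) abs_summable_on J" if "j \<in> J" for j
    using a_summable[OF that] by auto
  have *: "infsetsum (\<lambda>i. norm (v j * a j i)) J = \<bar>v j\<bar> * infsetsum (\<lambda>i. \<bar>a j i\<bar>) J" if "j \<in> J" for j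
    using abs_summable_on_normI[OF a_summable[OF that]]
    by (simp add: abs_mult infsetsum_cmult_right)
  have n: "0 \<le> infsetsum (\<lambda>i. \<bar>a j i\<bar>) J" for j by (intro infsetsum_nonneg) auto
  have "(\<lambda>j. infsetsum (\<lambda>i. norm (v j * a j i)) J) abs_summable_on J"
  proof (rule abs_summable_on_comparison_test')
    show "(\<lambda>j. K * \<bar>v j\<bar>) abs_summable_on J"
      using abs_summable_on_normI[OF assms] by (intro abs_summable_on_cmult_right) auto
    show "norm (infsetsum (\<lambda>i. norm (v j * a j i)) J) \<le> K * \<bar>v j\<bar>" if "j \<in> J" for j
      using *[OF that] n[of j] mult_right_mono[OF a_bound[OF that], of "\<bar>v j\<bar>"]
      by (simp add: abs_mult mult.commute)
  qed
  then show "(\<lambda>j. infsetsum (\<lambda>i. norm (case (j, i) of (j, i) \<Rightarrow> v j * a j i)) J) abs_summable_on J"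
    by simp
qed

lemma kernel_row:
  assumes "v abs_summable_on J" "i \<in> J"
  shows "(\<lambda>j. v j * a j i) abs_summable_on J"
proof -
  have "(\<lambda>(i, j). v j * a j i) abs_summable_on J \<times> J"
    using kernel_Times[OF assms(1)] by (subst abs_summable_on_Times_swap) auto
  from abs_summable_on_Sigma_project2[OF this assms(2)] show ?thesis by simp
qed

lemma kernel_op_summable:
  assumes "v abs_summable_on J"
  shows "kernel_op J a v abs_summable_on J"
proof -
  have "(\<lambda>(i, j). v j * a j i) abs_summable_on J \<times> J"
    using kernel_Times[OF assms(1)] by (subst abs_summable_on_Times_swap) auto
  from abs_summable_on_Sigma_project1'[OF this J] J show ?thesis by (simp add: kernel_op_def[abs_def])
qed

lemma kernel_op_bound:
  assumes "v abs_summable_on J"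
  shows "infsetsum (\<lambda>i. \<bar>kernel_op J a v i\<bar>) J \<le> K * infsetsum (\<lambda>i. \<bar>v i\<bar>) J"
proof -
  have s: "(\<lambda>(i, j). \<bar>v j * a j i\<bar>) abs_summable_on J \<times> J"
    using abs_summable_on_normI[OF kernel_Times[OF assms(1)]]
    by (subst abs_summable_on_Times_swap) (auto simp: case_prod_unfold)
  then have s': "(\<lambda>(i, j). \<bar>v i * a i j\<bar>) abs_summable_on J \<times> J"
    by (subst (asm) abs_summable_on_Times_swap) auto
  have "infsetsum (\<lambda>i. \<bar>kernel_op J a v i\<bar>) J \<le> infsetsum (\<lambda>i. infsetsum (\<lambda>j. \<bar>v j * a j i\<bar>) J) J"
  proof (rule infsetsum_mono)
    show "(\<lambda>i. \<bar>kernel_op J a v i\<bar>) abs_summable_on J"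
      using abs_summable_on_normI[OF kernel_op_summable[OF assms]] by simp
    show "(\<lambda>i. infsetsum (\<lambda>j. \<bar>v j * a j i\<bar>) J) abs_summable_on J"
      using abs_summable_on_Sigma_project1'[OF s J] J by simp
    show "\<bar>kernel_op J a v i\<bar> \<le> infsetsum (\<lambda>j. \<bar>v j * a j i\<bar>) J" for i
      using norm_infsetsum_bound[of "\<lambda>j. v j * a j i" J] by (simp add: kernel_op_def)
  qed
  also have "\<dots> = infsetsum (\<lambda>j. infsetsum (\<lambda>i. \<bar>v j * a j i\<bar>) J) J"
    using infsetsum_swap[OF J J s] .
  also have "\<dots> \<le> infsetsum (\<lambda>j. K * \<bar>v j\<bar>) J"
  proof (rule infsetsum_mono)
    show "(\<lambda>j. infsetsum (\<lambda>i. \<bar>v j * a j i\<bar>) J) abs_summable_on J"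
      using abs_summable_on_Sigma_project1'[OF s' J] J by simp
    show "(\<lambda>j. K * \<bar>v j\<bar>) abs_summable_on J"
      using abs_summable_on_normI[OF assms] by (intro abs_summable_on_cmult_right) auto
    show "infsetsum (\<lambda>i. \<bar>v j * a j i\<bar>) J \<le> K * \<bar>v j\<bar>" if "j \<in> J" for j
      using abs_summable_on_normI[OF a_summable[OF that]] mult_right_mono[OF a_bound[OF that], of "\<bar>v j\<bar>"]
      by (simp add: abs_mult infsetsum_cmult_right mult.commute)
  qed
  also have "\<dots> = K * infsetsum (\<lambda>i. \<bar>v i\<bar>) J"
    using abs_summable_on_normI[OF assms] by (intro infsetsum_cmult_right) auto
  finally show ?thesis .
qed

lemma kernel_op_add:
  assumes "v abs_summable_on J" "w abs_summable_on J" "i \<in> J"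
  shows "kernel_op J a (\<lambda>x. v x + w x) i = kernel_op J a v i + kernel_op J a w i"
  using kernel_row[OF assms(1,3)] kernel_row[OF assms(2,3)]
  by (simp add: kernel_op_def infsetsum_add[symmetric] distrib_right)

lemma kernel_op_scale:
  assumes "v abs_summable_on J" "i \<in> J"
  shows "kernel_op J a (\<lambda>x. c * v x) i = c * kernel_op J a v i"
  using kernel_row[OF assms] by (simp add: kernel_op_def mult.assoc infsetsum_cmult_right)

lemma kernel_op_indicator:
  assumes "S \<subseteq> J" "finite S"
  shows "kernel_op J a (\<lambda>j. of_bool (j \<in> S)) i = (\<Sum>j\<in>S. a j i)"
proof -
  have "kernel_op J a (\<lambda>j. of_bool (j \<in> S)) i = infsetsum (\<lambda>j. a j i) S"
    unfolding kernel_op_def using assms by (intro infsetsum_cong_neutral) auto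
  with assms show ?thesis by simp
qed

end

lemma abs_summable_finite_support:
  assumes "finite U" "\<And>i. i \<in> J - U \<Longrightarrow> f i = (0 :: real)" "U \<subseteq> J"
  shows "f abs_summable_on J" "infsetsum (\<lambda>i. \<bar>f i\<bar>) J = (\<Sum>i\<in>U. \<bar>f i\<bar>)"
proof -
  have "f abs_summable_on J \<longleftrightarrow> f abs_summable_on U"
    using assms by (intro abs_summable_on_cong_neutral) auto
  with assms show "f abs_summable_on J" by simp
  have "infsetsum (\<lambda>i. \<bar>f i\<bar>) J = infsetsum (\<lambda>i. \<bar>f i\<bar>) U"
    using assms by (intro infsetsum_cong_neutral) auto
  with assms show "infsetsum (\<lambda>i. \<bar>f i\<bar>) J = (\<Sum>i\<in>U. \<bar>f i\<bar>)" by simp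
qed

section \<open>Cocycles whose values are indicators of finite sets\<close>

locale kernel_cocycle = group \<Gamma> for \<Gamma> :: "('g, 'm) monoid_scheme" (structure) +
  fixes J :: "'j set" and A :: "'g \<Rightarrow> 'j \<Rightarrow> 'j \<Rightarrow> real" and S :: "'g \<Rightarrow> 'j set" and K :: real
  assumes J: "countable J" and K_ge: "1 \<le> K"
    and A_bound: "g \<in> carrier \<Gamma> \<Longrightarrow> j \<in> J \<Longrightarrow>
      \<exists>U. finite U \<and> U \<subseteq> J \<and> (\<forall>i\<in>J - U. A g j i = 0) \<and> (\<Sum>i\<in>U. \<bar>A g j i\<bar>) \<le> K"
    and S: "g \<in> carrier \<Gamma> \<Longrightarrow> finite (S g) \<and> S g \<subseteq> J"
    and S_one: "S \<one> = {}"
    and S_mult: "g \<in> carrier \<Gamma> \<Longrightarrow> h \<in> carrier \<Gamma> \<Longrightarrow> i \<in> J \<Longrightarrow>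
      of_bool (i \<in> S (g \<otimes> h)) = (\<Sum>j\<in>S h. A g j i) + of_bool (i \<in> S g)"
    and S_proper: "finite {g \<in> carrier \<Gamma>. real (card (S g)) \<le> R}"
begin

lemma L1_cocycle_kernel:
  "L1_cocycle \<Gamma> (count_space J) (\<lambda>g. kernel_op J (A g)) (\<lambda>g j. of_bool (j \<in> S g)) K"
proof
  have A1: "A g j abs_summable_on J" "infsetsum (\<lambda>i. \<bar>A g j i\<bar>) J \<le> K" if "g \<in> carrier \<Gamma>" "j \<in> J" for g j
  proof -
    obtain U where "finite U" "U \<subseteq> J" "\<forall>i\<in>J - U. A g j i = 0" "(\<Sum>i\<in>U. \<bar>A g j i\<bar>) \<le> K"
      using A_bound[OF \<open>g \<in> carrier \<Gamma>\<close> \<open>j \<in> J\<close>] by metis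
    with abs_summable_finite_support[of U J "A g j"]
    show "A g j abs_summable_on J" "infsetsum (\<lambda>i. \<bar>A g j i\<bar>) J \<le> K" by auto
  qed
  note [simp] = AE_count_space
  fix g assume g: "g \<in> carrier \<Gamma>"
  show "integrable (count_space J) (kernel_op J (A g) v)" if "integrable (count_space J) v" for v
    using kernel_op_summable[OF J A1[OF g]] that by (simp add: abs_summable_on_def)
  show "AE i in count_space J. kernel_op J (A g) (\<lambda>x. v x + w x) i = kernel_op J (A g) v i + kernel_op J (A g) w i"
    if "integrable (count_space J) v" "integrable (count_space J) w" for v w
    using kernel_op_add[OF J A1[OF g]] that by (simp add: abs_summable_on_def)
  show "AE i in count_space J. kernel_op J (A g) (\<lambda>x. c * v x) i = c * kernel_op J (A g) v i"
    if "integrable (count_space J) v" for v c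
    using kernel_op_scale[OF J A1[OF g]] that by (simp add: abs_summable_on_def)
  show "(\<integral>x. \<bar>kernel_op J (A g) v x\<bar> \<partial>count_space J) \<le> K * (\<integral>x. \<bar>v x\<bar> \<partial>count_space J)"
    if "integrable (count_space J) v" for v
    using kernel_op_bound[OF J A1[OF g]] that by (simp add: abs_summable_on_def infsetsum_def)
  show "integrable (count_space J) (\<lambda>j. of_bool (j \<in> S g) :: real)"
    using abs_summable_finite_support[of "S g" J "\<lambda>j. of_bool (j \<in> S g)"] S[OF g] by (simp add: abs_summable_on_def)
  show "AE i in count_space J. of_bool (i \<in> S (g \<otimes> h)) =
      kernel_op J (A g) (\<lambda>j. of_bool (j \<in> S h)) i + of_bool (i \<in> S g)" if "h \<in> carrier \<Gamma>" for h
    using kernel_op_indicator[OF J A1[OF g], where S = "S h"] S[OF that] S_mult[OF g that] by simp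
next
  have "(\<integral>x. \<bar>of_bool (x \<in> S g) :: real\<bar> \<partial>count_space J) = real (card (S g))" if "g \<in> carrier \<Gamma>" for g
    using abs_summable_finite_support(2)[of "S g" J "\<lambda>j. of_bool (j \<in> S g)"] S[OF that] by (simp add: infsetsum_def)
  then show "finite {g \<in> carrier \<Gamma>. (\<integral>x. \<bar>of_bool (x \<in> S g) :: real\<bar> \<partial>count_space J) \<le> R}" for R
    using S_proper[of R] by (simp cong: conj_cong)
qed (simp_all add: S_one K_ge)

text \<open>Serves to move the index set into the reals, where the measure space of the theorem has
  to live.\<close>

lemma kernel_cocycle_image:
  assumes "inj_on e J"
  shows "kernel_cocycle \<Gamma> (e ` J) (\<lambda>g r s. A g (inv_into J e r) (inv_into J e s)) (\<lambda>g. e ` S g) K"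
proof
  have [simp]: "inv_into J e (e j) = j" if "j \<in> J" for j using assms that by simp
  have memS: "e i \<in> e ` S g \<longleftrightarrow> i \<in> S g" if "g \<in> carrier \<Gamma>" "i \<in> J" for g i
    using S[OF that(1)] that(2) assms by (auto dest: inj_onD)
  show "countable (e ` J)" using J by simp
  show "\<exists>U. finite U \<and> U \<subseteq> e ` J \<and> (\<forall>i\<in>e ` J - U. A g (inv_into J e j) (inv_into J e i) = 0) \<and>
      (\<Sum>i\<in>U. \<bar>A g (inv_into J e j) (inv_into J e i)\<bar>) \<le> K" if g: "g \<in> carrier \<Gamma>" and j: "j \<in> e ` J" for g j
  proof -
    obtain j' where j': "j' \<in> J" "j = e j'" using j by blast
    obtain U where U: "finite U" "U \<subseteq> J" "\<forall>i\<in>J - U. A g j' i = 0" "(\<Sum>i\<in>U. \<bar>A g j' i\<bar>) \<le> K"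
      using A_bound[OF g j'(1)] by blast
    have "(\<Sum>i\<in>e ` U. \<bar>A g j' (inv_into J e i)\<bar>) = (\<Sum>i\<in>U. \<bar>A g j' (inv_into J e (e i))\<bar>)"
      using inj_on_subset[OF assms U(2)] by (simp add: sum.reindex)
    also have "\<dots> = (\<Sum>i\<in>U. \<bar>A g j' i\<bar>)" using U(2) by (intro sum.cong) auto
    finally show ?thesis using U j' by (intro exI[of _ "e ` U"]) auto
  qed
  show "of_bool (i \<in> e ` S (g \<otimes> h)) = (\<Sum>j\<in>e ` S h. A g (inv_into J e j) (inv_into J e i)) + of_bool (i \<in> e ` S g)"
    if g: "g \<in> carrier \<Gamma>" and h: "h \<in> carrier \<Gamma>" and i: "i \<in> e ` J" for g h i
  proof -
    obtain i' where i': "i' \<in> J" "i = e i'" using i by blast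
    have sub: "S h \<subseteq> J" using S[OF h] by blast
    have "(\<Sum>j\<in>e ` S h. A g (inv_into J e j) i') = (\<Sum>j\<in>S h. A g (inv_into J e (e j)) i')"
      using inj_on_subset[OF assms sub] by (simp add: sum.reindex)
    also have "\<dots> = (\<Sum>j\<in>S h. A g j i')" using sub by (intro sum.cong) auto
    finally show ?thesis using S_mult[OF g h i'(1)] i' memS g h by simp
  qed
  have "card (e ` S g) = card (S g)" if "g \<in> carrier \<Gamma>" for g
    using S[OF that] assms by (intro card_image) (auto intro: inj_on_subset)
  then show "finite {g \<in> carrier \<Gamma>. real (card (e ` S g)) \<le> R}" for R
    using S_proper[of R] by (simp cong: conj_cong)
qed (use S S_one K_ge in auto)

lemma L1_real_action:
  "\<exists>(M :: real measure) S E \<pi> b. closed_subspace S (L1 M) \<and> E = subspace_of (L1 M) S \<and>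
    affine_action \<Gamma> E \<pi> b \<and> uniformly_Lipschitz \<Gamma> E (affine_map E \<pi> b) \<and>
    proper_action \<Gamma> (vecs E) (vdist E) (affine_map E \<pi> b)"
proof -
  let ?e = "\<lambda>j. real (to_nat_on J j)"
  have "inj_on ?e J" using inj_on_to_nat_on[OF J] by (auto simp: inj_on_def)
  from kernel_cocycle.L1_cocycle_kernel[OF kernel_cocycle_image[OF this]]
  show ?thesis using L1_cocycle.L1_action by blast
qed

end

section \<open>Trees and quasi-trees\<close>

text \<open>A coarse thinness of triangles. The sides are chains with jumps up to \<open>K\<close>
  because a quasi-isometry turns walks into such chains.\<close>

definition tripod :: "'a set \<Rightarrow> ('a \<Rightarrow> 'a \<Rightarrow> real) \<Rightarrow> real \<Rightarrow> real \<Rightarrow> bool" where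
  "tripod V \<rho> K B \<longleftrightarrow> (\<forall>b0\<in>V. \<forall>x\<in>V. \<forall>y\<in>V. \<forall>xs ps qs.
     chain (\<lambda>u v. u \<in> V \<and> v \<in> V \<and> \<rho> u v \<le> K) x xs y \<longrightarrow>
     chain (\<lambda>u v. u \<in> V \<and> v \<in> V \<and> \<rho> u v \<le> K) b0 ps x \<longrightarrow>
     chain (\<lambda>u v. u \<in> V \<and> v \<in> V \<and> \<rho> u v \<le> K) b0 qs y \<longrightarrow>
     (\<exists>z\<in>insert x (set xs). \<exists>p\<in>insert b0 (set ps). \<exists>q\<in>insert b0 (set qs). \<rho> z p \<le> B \<and> \<rho> z q \<le> B))"

text \<open>Serves three maps: the quasi-isometry to a tree, the coordinate projections of the
  product, and the identity for enlarging the bound.\<close>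

lemma tripod_pullback:
  assumes T: "tripod W \<sigma> L B'" and f: "f \<in> V \<rightarrow> W"
    and up: "\<And>x y. x \<in> V \<Longrightarrow> y \<in> V \<Longrightarrow> \<rho> x y \<le> K \<Longrightarrow> \<sigma> (f x) (f y) \<le> L"
    and low: "\<And>x y. x \<in> V \<Longrightarrow> y \<in> V \<Longrightarrow> \<sigma> (f x) (f y) \<le> B' \<Longrightarrow> \<rho> x y \<le> B"
  shows "tripod V \<rho> K B"
  unfolding tripod_def
proof (intro ballI allI impI)
  let ?R = "\<lambda>u v. u \<in> V \<and> v \<in> V \<and> \<rho> u v \<le> K" and ?S = "\<lambda>u v. u \<in> W \<and> v \<in> W \<and> \<sigma> u v \<le> L"
  fix b0 x y xs ps qs
  assume V: "b0 \<in> V" "x \<in> V" "y \<in> V" and c: "chain ?R x xs y" "chain ?R b0 ps x" "chain ?R b0 qs y"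
  have map: "chain ?S (f u) (map f us) (f v)" if "chain ?R u us v" for u us v
    using that by (rule chain_map) (use f up in auto)
  have inV: "insert u (set us) \<subseteq> V" if "chain ?R u us v" "u \<in> V" for u us v
    using chain_in[OF that(1) _ that(2)] by auto
  have "\<exists>z\<in>insert (f x) (set (map f xs)). \<exists>p\<in>insert (f b0) (set (map f ps)). \<exists>q\<in>insert (f b0) (set (map f qs)).
      \<sigma> z p \<le> B' \<and> \<sigma> z q \<le> B'"
    using T[unfolded tripod_def, rule_format, OF _ _ _ map[OF c(1)] map[OF c(2)] map[OF c(3)]] V f by blast
  then obtain z p q where z: "z \<in> insert x (set xs)" "p \<in> insert b0 (set ps)" "q \<in> insert b0 (set qs)"
    "\<sigma> (f z) (f p) \<le> B'" "\<sigma> (f z) (f q) \<le> B'"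
    by auto
  moreover have "z \<in> V" "p \<in> V" "q \<in> V" using z inV[OF c(1)] inV[OF c(2)] inV[OF c(3)] V by auto
  ultimately show "\<exists>z\<in>insert x (set xs). \<exists>p\<in>insert b0 (set ps). \<exists>q\<in>insert b0 (set qs). \<rho> z p \<le> B \<and> \<rho> z q \<le> B"
    using low by blast
qed

context graph_metric begin

text \<open>Each jump is filled in by a geodesic, whose points are within \<open>K\<close> of the
  start of the jump.\<close>

lemma coarse_chain_fill:
  assumes "chain (\<lambda>u v. u \<in> V \<and> v \<in> V \<and> real (d u v) \<le> K) x xs y" "x \<in> V" "0 \<le> K"
  shows "\<exists>ys. chain adj x ys y \<and> (\<forall>w\<in>insert x (set ys). w \<in> V \<and> (\<exists>z\<in>insert x (set xs). z \<in> V \<and> real (d z w) \<le> K))"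
  using assms
proof (induction xs arbitrary: x)
  case Nil
  then show ?case by (intro exI[of _ "[]"]) (auto simp: d_refl)
next
  case (Cons z zs)
  then have z: "z \<in> V" "real (d x z) \<le> K" by auto
  obtain P where P: "geod x P z" using geod_ex Cons.prems z by blast
  obtain ys where ys: "chain adj z ys y"
    "\<forall>w\<in>insert z (set ys). w \<in> V \<and> (\<exists>u\<in>insert z (set zs). u \<in> V \<and> real (d u w) \<le> K)"
    using Cons.IH[of z] Cons.prems z unfolding chain.simps by blast
  have "w \<in> V \<and> real (d x w) \<le> K" if "w \<in> insert x (set P)" for w
    using geod_between[OF P that Cons.prems(2)] z by auto
  then show ?case using P ys Cons.prems
    by (intro exI[of _ "P @ ys"]) (auto simp: chain_append geod_def)
qed

lemma first_in_chain:
  assumes "chain adj c W a" "a \<in> I"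
  shows "\<exists>us vs m. m \<in> I \<and> chain adj c us m \<and> chain adj m vs a \<and> W = us @ vs \<and> (insert c (set us)) \<inter> I \<subseteq> {m}"
  using assms(1)
proof (induction W arbitrary: c)
  case Nil
  with assms(2) show ?case by (intro exI[of _ "[]"]) auto
next
  case (Cons z W)
  show ?case
  proof (cases "c \<in> I")
    case True
    with Cons.prems have "c \<in> I \<and> chain adj c [] c \<and> chain adj c (z # W) a \<and> z # W = [] @ z # W \<and>
        insert c (set []) \<inter> I \<subseteq> {c}" by simp
    then show ?thesis by blast
  next
    case False
    obtain us vs m where m: "m \<in> I" "chain adj z us m" "chain adj m vs a" "W = us @ vs" "(insert z (set us)) \<inter> I \<subseteq> {m}"
      using Cons.IH[of z] Cons.prems unfolding chain.simps by blast
    with False Cons.prems have "m \<in> I \<and> chain adj c (z # us) m \<and> chain adj m vs a \<and> z # W = (z # us) @ vs \<and>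
        insert c (set (z # us)) \<inter> I \<subseteq> {m}" by simp
    then show ?thesis by blast
  qed
qed

text \<open>\<open>m\<close> is the first point of the interval between \<open>a\<close> and
  \<open>b\<close> on a geodesic from \<open>c\<close> to \<open>a\<close>. It lies between
  \<open>a\<close> and \<open>b\<close> and between \<open>c\<close> and \<open>a\<close>, so the
  bottleneck property puts it on walks of these two kinds; walks from \<open>c\<close> to
  \<open>b\<close> are met up to distance 1.\<close>

lemma median:
  assumes bottleneck: "\<And>a b m xs. a \<in> V \<Longrightarrow> b \<in> V \<Longrightarrow> m \<in> V \<Longrightarrow> d a m + d m b = d a b \<Longrightarrow>
      chain adj a xs b \<Longrightarrow> m \<in> insert a (set xs)"
    and V: "a \<in> V" "b \<in> V" "c \<in> V"
  shows "\<exists>m\<in>V. (\<forall>xs. chain adj c xs a \<longrightarrow> (\<exists>z\<in>insert c (set xs). d z m \<le> 1)) \<and>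
    (\<forall>xs. chain adj c xs b \<longrightarrow> (\<exists>z\<in>insert c (set xs). d z m \<le> 1)) \<and>
    (\<forall>xs. chain adj a xs b \<longrightarrow> (\<exists>z\<in>insert a (set xs). d z m \<le> 1))"
proof -
  let ?I = "{m\<in>V. d a m + d m b = d a b}"
  obtain W where W: "geod c W a" using geod_ex V by blast
  have "a \<in> ?I" using V by (simp add: d_refl)
  then obtain us vs m where m: "m \<in> ?I" "chain adj c us m" "chain adj m vs a" "W = us @ vs"
    "(insert c (set us)) \<inter> ?I \<subseteq> {m}"
    using first_in_chain[of c W a ?I] W unfolding geod_def by blast
  have mW: "m \<in> insert c (set W)" using chain_last[OF m(2)] m(4) by auto
  have cma: "d c m + d m a = d c a" using geod_between[OF W mW V(3)] by simp
  have near: "\<exists>z\<in>insert x (set xs). d z m \<le> 1" if "m \<in> insert x (set xs)" for x xs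
    using that m(1) by (intro bexI[of _ m]) (auto simp: d_refl)
  have "\<exists>z\<in>insert c (set U). d z m \<le> 1" if U: "chain adj c U b" for U
  proof (cases "m = b")
    case True
    then show ?thesis using near chain_last[OF U] by blast
  next
    case False
    \<comment> \<open>\<open>m'\<close> follows \<open>m\<close> towards \<open>b\<close> and is
      still in the interval, so the geodesic from \<open>c\<close> to \<open>m\<close> avoids it.
      The walk from \<open>m\<close> back to \<open>c\<close> and then along \<open>U\<close> to
      \<open>b\<close> must contain it, hence so must \<open>U\<close>.\<close>
    then obtain m' where m': "m' \<in> V" "d m m' = 1" "d m b = Suc (d m' b)" using d_step m(1) V by blast
    have "d a b \<le> d a m' + d m' b" "d a m' \<le> d a m + d m m'"
      using d_tri[of a m' b] d_tri[of a m m'] V m' m(1) by auto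
    then have I: "m' \<in> ?I" using m' m(1) by auto
    obtain Q where Q: "chain adj m Q c" "insert m (set Q) = insert c (set us)"
      using chain_rev_set[OF m(2)] by blast
    have "chain adj m (Q @ U) b" using Q U by (auto simp: chain_append)
    then have "m' \<in> insert m (set (Q @ U))" using m' m(1) V by (intro bottleneck[of m b]) auto
    moreover have "m' \<noteq> m" using m' by (auto simp: d_refl)
    moreover have "m' \<notin> insert m (set Q)" using I m(5) \<open>m' \<noteq> m\<close> Q by auto
    ultimately have "m' \<in> set U" by auto
    moreover have "d m' m = 1" using m' m(1) d_sym[of m' m] by simp
    ultimately show ?thesis by (intro bexI[of _ m']) auto
  qed
  moreover have "\<exists>z\<in>insert c (set U). d z m \<le> 1" if U: "chain adj c U a" for U
    using near[OF bottleneck[OF V(3,1) _ cma U]] m(1) by simp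
  moreover have "\<exists>z\<in>insert a (set U). d z m \<le> 1" if U: "chain adj a U b" for U
    using near[OF bottleneck[OF V(1,2) _ _ U]] m(1) by simp
  ultimately show ?thesis using m(1) by blast
qed

text \<open>Once filled in, every side passes within 1 of the median, so the chain itself comes
  within \<open>K + 1\<close> of it.\<close>

lemma bottleneck_tripod:
  assumes bottleneck: "\<And>a b m xs. a \<in> V \<Longrightarrow> b \<in> V \<Longrightarrow> m \<in> V \<Longrightarrow> d a m + d m b = d a b \<Longrightarrow>
      chain adj a xs b \<Longrightarrow> m \<in> insert a (set xs)"
    and K: "0 \<le> K"
  shows "tripod V (\<lambda>x y. real (d x y)) K (2 * (K + 1))"
  unfolding tripod_def
proof (intro ballI allI impI)
  let ?R = "\<lambda>u v. u \<in> V \<and> v \<in> V \<and> real (d u v) \<le> K"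
  fix c a b xs ps qs
  assume V: "c \<in> V" "a \<in> V" "b \<in> V" and ch: "chain ?R a xs b" "chain ?R c ps a" "chain ?R c qs b"
  obtain m where m: "m \<in> V" "\<And>xs. chain adj c xs a \<Longrightarrow> \<exists>z\<in>insert c (set xs). d z m \<le> 1"
    "\<And>xs. chain adj c xs b \<Longrightarrow> \<exists>z\<in>insert c (set xs). d z m \<le> 1"
    "\<And>xs. chain adj a xs b \<Longrightarrow> \<exists>z\<in>insert a (set xs). d z m \<le> 1"
    using median[of a b c] bottleneck V by metis
  have *: "\<exists>z\<in>insert x (set zs). z \<in> V \<and> real (d z m) \<le> K + 1"
    if ch: "chain ?R x zs y" and x: "x \<in> V" and 1: "\<And>xs. chain adj x xs y \<Longrightarrow> \<exists>z\<in>insert x (set xs). d z m \<le> 1" for x y zs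
  proof -
    obtain ys where ys: "chain adj x ys y"
      "\<forall>w\<in>insert x (set ys). w \<in> V \<and> (\<exists>z\<in>insert x (set zs). z \<in> V \<and> real (d z w) \<le> K)"
      using coarse_chain_fill[OF ch x K] by blast
    then obtain w where w: "w \<in> insert x (set ys)" "d w m \<le> 1" using 1 by blast
    then obtain z where z: "z\<in>insert x (set zs)" "z \<in> V" "real (d z w) \<le> K" "w \<in> V" using ys by blast
    have "d z m \<le> d z w + d w m" using d_tri z m by blast
    then have "real (d z m) \<le> K + 1" using z w by linarith
    with z show ?thesis by blast
  qed
  obtain z where z: "z\<in>insert a (set xs)" "z \<in> V" "real (d z m) \<le> K + 1" using *[OF ch(1) V(2) m(4)] by blast
  obtain p where p: "p\<in>insert c (set ps)" "p \<in> V" "real (d p m) \<le> K + 1" using *[OF ch(2) V(1) m(2)] by blast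
  obtain q where q: "q\<in>insert c (set qs)" "q \<in> V" "real (d q m) \<le> K + 1" using *[OF ch(3) V(1) m(3)] by blast
  have "real (d z w) \<le> 2 * (K + 1)" if "w \<in> V" "real (d w m) \<le> K + 1" for w
  proof -
    have "d z w \<le> d z m + d w m" using d_tri[of z m w] d_sym[of m w] z m that by simp
    then have "real (d z w) \<le> real (d z m) + real (d w m)" by (simp only: of_nat_add[symmetric] of_nat_le_iff)
    also have "\<dots> \<le> (K + 1) + (K + 1)" using that(2) z(3) by (intro add_mono)
    finally show ?thesis by simp
  qed
  with z p q show "\<exists>z\<in>insert a (set xs). \<exists>p\<in>insert c (set ps). \<exists>q\<in>insert c (set qs).
      real (d z p) \<le> 2 * (K + 1) \<and> real (d z q) \<le> 2 * (K + 1)" by blast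
qed

end

section \<open>Connected graphs as graph metrics, and the bottleneck property of trees\<close>

definition nat_dist :: "'v pair_pre_digraph \<Rightarrow> 'v \<Rightarrow> 'v \<Rightarrow> nat" where
  "nat_dist G u v = (LEAST n. \<exists>p. pre_digraph.awalk (with_proj G) u p v \<and> length p = n)"

locale connected_pair_graph = pair_bidirected_digraph G for G :: "'v pair_pre_digraph" +
  assumes conn: "strongly_connected (with_proj G)"
begin

lemma awalk_ex: "u \<in> pverts G \<Longrightarrow> v \<in> pverts G \<Longrightarrow> \<exists>p. awalk u p v"
  using conn unfolding strongly_connected_def reachable_awalk[symmetric] by simp

lemma nat_dist_awalk:
  assumes "u \<in> pverts G" "v \<in> pverts G"
  obtains p where "awalk u p v" "length p = nat_dist G u v"
proof -
  have "\<exists>n p. awalk u p v \<and> length p = n" using awalk_ex assms by blast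
  from LeastI_ex[OF this] show thesis using that unfolding nat_dist_def by blast
qed

lemma nat_dist_le: "awalk u p v \<Longrightarrow> nat_dist G u v \<le> length p"
  unfolding nat_dist_def by (rule Least_le) blast

lemma graph_dist_nat:
  assumes "u \<in> pverts G" "v \<in> pverts G"
  shows "graph_dist G u v = real (nat_dist G u v)"
proof -
  have cost: "awalk_cost (\<lambda>_. 1) p = real (length p)" for p :: "('v \<times> 'v) list"
    by (induction p) auto
  obtain p where p: "awalk u p v" "length p = nat_dist G u v" using nat_dist_awalk[OF assms] .
  have "\<mu> (\<lambda>_. 1) u v = ereal (real (nat_dist G u v))"
    unfolding \<mu>_def cost
  proof (rule antisym)
    show "(INF p\<in>{p. awalk u p v}. ereal (real (length p))) \<le> ereal (real (nat_dist G u v))"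
      using p by (intro INF_lower2[of p]) auto
    show "ereal (real (nat_dist G u v)) \<le> (INF p\<in>{p. awalk u p v}. ereal (real (length p)))"
      by (intro INF_greatest) (auto intro: nat_dist_le)
  qed
  then show ?thesis by (simp add: graph_dist_def)
qed

lemma nat_dist_arc:
  assumes "(u, v) \<in> parcs G"
  shows "nat_dist G u v = 1"
proof -
  have "awalk u [(u, v)] v" using assms by (auto simp: awalk_simps intro: in_arcsD2)
  from nat_dist_le[OF this] have "nat_dist G u v \<le> 1" by simp
  moreover have "nat_dist G u v \<noteq> 0"
  proof
    assume "nat_dist G u v = 0"
    moreover obtain p where "awalk u p v" "length p = nat_dist G u v"
      using nat_dist_awalk[OF in_arcsD1[OF assms] in_arcsD2[OF assms]] .
    ultimately have "awalk u [] v" by simp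
    then have "u = v" by (rule awalk_empty_ends)
    then show False using pair_no_loops[OF assms] by simp
  qed
  ultimately show ?thesis by simp
qed

sublocale graph_metric "pverts G" "nat_dist G"
proof
  fix x y z assume x: "x \<in> pverts G" and y: "y \<in> pverts G"
  show "(nat_dist G x y = 0) = (x = y)"
  proof
    assume "nat_dist G x y = 0"
    then obtain p where "awalk x p y" "length p = 0" using nat_dist_awalk[OF x y] by metis
    then show "x = y" by (simp add: awalk_simps)
  next
    assume "x = y"
    then show "nat_dist G x y = 0" using nat_dist_le[of x "[]" y] x by (simp add: awalk_simps)
  qed
  have le: "nat_dist G x y \<le> nat_dist G y x" if V: "x \<in> pverts G" "y \<in> pverts G" for x y
  proof -
    obtain p where p: "awalk y p x" "length p = nat_dist G y x" using nat_dist_awalk[OF V(2,1)] .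
    have "length (rev_path p) = length p" by (induction p) auto
    with p nat_dist_le[of x "rev_path p" y] show ?thesis by simp
  qed
  show "nat_dist G x y = nat_dist G y x" using le x y by (intro antisym)
  have tri: "nat_dist G x z \<le> nat_dist G x y + nat_dist G y z" if V: "x \<in> pverts G" "y \<in> pverts G" "z \<in> pverts G" for x y z
  proof -
    obtain p where p: "awalk x p y" "length p = nat_dist G x y" using nat_dist_awalk[OF V(1,2)] .
    obtain q where q: "awalk y q z" "length q = nat_dist G y z" using nat_dist_awalk[OF V(2,3)] .
    with p have "awalk x (p @ q) z" by (blast intro: awalk_appendI)
    from nat_dist_le[OF this] p q show ?thesis by simp
  qed
  show "nat_dist G x z \<le> nat_dist G x y + nat_dist G y z" if "z \<in> pverts G" using tri x y that .
  assume "x \<noteq> y"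
  obtain p where p: "awalk x p y" "length p = nat_dist G x y" using nat_dist_awalk[OF x y] .
  with \<open>x \<noteq> y\<close> obtain e es where e: "p = e # es" by (cases p) (auto simp: awalk_simps)
  with p have e': "e \<in> parcs G" "fst e = x" "awalk (snd e) es y" by (auto simp: awalk_simps)
  then have z: "snd e \<in> pverts G" "nat_dist G x (snd e) = 1"
    using arc_snd_in_verts nat_dist_arc[of x "snd e"] by auto
  moreover have "nat_dist G x y = Suc (nat_dist G (snd e) y)"
    using nat_dist_le[OF e'(3)] p e tri[OF x z(1) y] z by simp
  ultimately show "\<exists>z\<in>pverts G. nat_dist G x z = 1 \<and> nat_dist G x y = Suc (nat_dist G z y)" by blast
qed

lemma adj_arc: "adj u v \<Longrightarrow> (u, v) \<in> parcs G"
proof -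
  assume "adj u v"
  then obtain p where "awalk u p v" "length p = 1" using nat_dist_awalk[of u v] by (auto simp: adj_def)
  then show ?thesis by (cases p) (auto simp: awalk_simps)
qed

lemma chain_awalk:
  "chain adj a xs b \<Longrightarrow> a \<in> pverts G \<Longrightarrow> \<exists>p. awalk a p b \<and> set (awalk_verts a p) = insert a (set xs)"
proof (induction xs arbitrary: a)
  case Nil
  then show ?case by (intro exI[of _ "[]"]) (auto simp: awalk_simps)
next
  case (Cons z zs)
  then have z: "(a, z) \<in> parcs G" "z \<in> pverts G" using adj_arc adjD by auto
  obtain p where "awalk z p b" "set (awalk_verts z p) = insert z (set zs)" using Cons z by auto
  with z show ?case by (intro exI[of _ "(a, z) # p"]) (auto simp: awalk_simps)
qed

lemma shortest_apath:
  assumes "awalk u p v" "length p = nat_dist G u v"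
  shows "apath u p v"
proof (rule ccontr)
  assume "\<not> apath u p v"
  then have "\<not> distinct (awalk_verts u p)" using assms(1) by (simp add: apath_def)
  from awalk_not_distinct_decomp[OF assms(1) this] obtain q r s w where
    w: "p = q @ r @ s" "0 < length r" "awalk u q w" "awalk w s v" by blast
  from nat_dist_le[OF awalk_appendI[OF w(3,4)]] w assms(2) show False by (cases r) auto
qed

text \<open>Shortest walks from \<open>a\<close> to \<open>m\<close> and from \<open>m\<close> to
  \<open>b\<close> join to a shortest walk, which is a simple path. The given walk also shortens to
  a simple path, by uniqueness the same one, so it visits \<open>m\<close>.\<close>

lemma tree_bottleneck:
  assumes T: "is_tree G" and V: "a \<in> pverts G" "b \<in> pverts G" "m \<in> pverts G"
    and m: "nat_dist G a m + nat_dist G m b = nat_dist G a b" and ch: "chain adj a xs b"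
  shows "m \<in> insert a (set xs)"
proof -
  obtain p where p: "awalk a p b" "set (awalk_verts a p) = insert a (set xs)" using chain_awalk[OF ch V(1)] by blast
  obtain q1 q2 where q: "awalk a q1 m" "length q1 = nat_dist G a m" "awalk m q2 b" "length q2 = nat_dist G m b"
    using nat_dist_awalk V by metis
  have aw: "awalk a (q1 @ q2) b" using q by (blast intro: awalk_appendI)
  then have "apath a (q1 @ q2) b" using q m by (intro shortest_apath) auto
  moreover have "apath a (awalk_to_apath p) b" using p(1) by (rule apath_awalk_to_apath)
  ultimately have eq: "q1 @ q2 = awalk_to_apath p" using T V unfolding is_tree_def by blast
  have sub: "set (awalk_to_apath p) \<subseteq> set p" using p(1) by (rule awalk_to_apath_subset)
  have "m \<in> set (awalk_verts a q1) \<union> set (awalk_verts m q2)" using q(3) hd_in_awalk_verts by blast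
  then have "m \<in> set (awalk_verts a (q1 @ q2))" using set_awalk_verts_append[OF q(1,3)] by simp
  then have "m \<in> {a} \<union> set (map fst (q1 @ q2)) \<union> set (map snd (q1 @ q2))" using set_awalk_verts[OF aw] by simp
  then have "m \<in> {a} \<union> set (map fst p) \<union> set (map snd p)" using eq sub by auto
  then show ?thesis using set_awalk_verts[OF p(1)] p(2) by simp
qed

end

lemma connected_pair_graph_iff: "connected_graph G \<longleftrightarrow> connected_pair_graph G"
  unfolding connected_graph_def connected_pair_graph_def connected_pair_graph_axioms_def ..

lemma quasi_tree_tripod:
  assumes "quasi_tree TYPE('w) X"
  shows "\<exists>B. tripod (pverts X) (graph_dist X) 1 B"
proof -
  obtain T :: "'w pair_pre_digraph" and L C f where T: "is_tree T" and L: "1 \<le> L" "0 < C"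
    and f: "quasi_isometry L C (pverts X) (graph_dist X) (pverts T) (graph_dist T) f"
    using assms unfolding quasi_tree_def quasi_isometric_def by blast
  have "connected_graph T" using T by (simp add: is_tree_def)
  then interpret T: connected_pair_graph T by (simp only: connected_pair_graph_iff)
  \<comment> \<open>The quasi-isometry sends points at distance at most 1 to points at distance at
    most \<open>L + C\<close>.\<close>
  let ?K = "L + C"
  have "tripod (pverts T) (\<lambda>x y. real (nat_dist T x y)) ?K (2 * (?K + 1))"
    using L by (intro T.bottleneck_tripod T.tree_bottleneck T) auto
  \<comment> \<open>Images at distance at most \<open>r\<close> come from points at distance at most
    \<open>L * (r + C)\<close>.\<close>
  then have "tripod (pverts X) (graph_dist X) 1 (L * (2 * (?K + 1) + C))"
  proof (rule tripod_pullback)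
    show fT: "f \<in> pverts X \<rightarrow> pverts T" using f by (simp add: quasi_isometry_def)
    fix x y assume V: "x \<in> pverts X" "y \<in> pverts X"
    then have n: "real (nat_dist T (f x) (f y)) = graph_dist T (f x) (f y)"
      using fT by (subst T.graph_dist_nat) auto
    have qi: "1 / L * graph_dist X x y - C \<le> graph_dist T (f x) (f y)"
      "graph_dist T (f x) (f y) \<le> L * graph_dist X x y + C"
      using f V by (auto simp: quasi_isometry_def)
    show "real (nat_dist T (f x) (f y)) \<le> ?K" if "graph_dist X x y \<le> 1"
      using n qi(2) mult_left_mono[OF that, of L] L by linarith
    show "graph_dist X x y \<le> L * (2 * (?K + 1) + C)" if "real (nat_dist T (f x) (f y)) \<le> 2 * (?K + 1)"
    proof -
      have "graph_dist X x y / L \<le> 2 * (?K + 1) + C" using that n qi(1) by simp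
      then show ?thesis using L by (simp add: divide_le_eq mult.commute)
    qed
  qed
  then show ?thesis by blast
qed

section \<open>Groups acting on products of quasi-trees\<close>

text \<open>The vertex sets may be uncountable while the cuts must be countable, so the construction
  runs inside a countable invariant set of vertices.\<close>

lemma countable_closure:
  assumes "countable I" "x0 \<in> X" "\<And>i x. i \<in> I \<Longrightarrow> x \<in> X \<Longrightarrow> f i x \<in> X"
    "\<And>x y. x \<in> X \<Longrightarrow> y \<in> X \<Longrightarrow> h x y \<in> X"
  shows "\<exists>V\<subseteq>X. countable V \<and> x0 \<in> V \<and> (\<forall>i\<in>I. \<forall>x\<in>V. f i x \<in> V) \<and> (\<forall>x\<in>V. \<forall>y\<in>V. h x y \<in> V)"
proof -
  define step where "step S = S \<union> (\<lambda>(i, x). f i x) ` (I \<times> S) \<union> (\<lambda>(x, y). h x y) ` (S \<times> S)" for S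
  define V where "V n = (step ^^ n) {x0}" for n
  have V_Suc: "V (Suc n) = step (V n)" for n by (simp add: V_def)
  have "V n \<subseteq> X \<and> countable (V n)" for n
  proof (induction n)
    case 0
    then show ?case using assms by (simp add: V_def)
  next
    case (Suc n)
    then have "f i x \<in> X" if "i \<in> I" "x \<in> V n" for i x using assms(3) that by blast
    moreover have "h x y \<in> X" if "x \<in> V n" "y \<in> V n" for x y using Suc assms(4) that by blast
    ultimately have "step (V n) \<subseteq> X" using Suc by (auto simp: step_def)
    moreover have "countable (step (V n))" using Suc assms(1) by (simp add: step_def)
    ultimately show ?case by (simp add: V_Suc)
  qed
  moreover have mono: "V m \<subseteq> V n" if "m \<le> n" for m n
    using that by (induction n rule: dec_induct) (auto simp: V_Suc step_def)
  have "h x y \<in> (\<Union>n. V n)" if xy: "x \<in> V m" "y \<in> V n" for x y m n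
  proof -
    have "x \<in> V (max m n)" "y \<in> V (max m n)" using mono[of m "max m n"] mono[of n "max m n"] xy by auto
    then have "h x y \<in> V (Suc (max m n))" unfolding V_Suc step_def by force
    then show ?thesis by blast
  qed
  moreover have "f i x \<in> (\<Union>n. V n)" if "i \<in> I" "x \<in> V n" for i x n
  proof -
    have "f i x \<in> V (Suc n)" unfolding V_Suc step_def using that by force
    then show ?thesis by blast
  qed
  moreover have "x0 \<in> V 0" by (simp add: V_def)
  ultimately show ?thesis by (intro exI[of _ "\<Union>n. V n"]) (auto intro: countable_UN)
qed

section \<open>The product graph and the directions of its edges\<close>

locale product_graph =
  fixes N :: nat and X :: "nat \<Rightarrow> 'v pair_pre_digraph"
  assumes factor: "i \<in> {1..N} \<Longrightarrow> connected_pair_graph (X i)"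
begin

abbreviation PV :: "(nat \<Rightarrow> 'v) set" where "PV \<equiv> product_verts N X"

definition pd :: "(nat \<Rightarrow> 'v) \<Rightarrow> (nat \<Rightarrow> 'v) \<Rightarrow> nat" where
  "pd x y = (\<Sum>i=1..N. nat_dist (X i) (x i) (y i))"

lemma PV_in: "x \<in> PV \<Longrightarrow> i \<in> {1..N} \<Longrightarrow> x i \<in> pverts (X i)"
  by (auto simp: product_verts_def)

lemma factor_metric: "i \<in> {1..N} \<Longrightarrow> graph_metric (pverts (X i)) (nat_dist (X i))"
proof -
  assume "i \<in> {1..N}"
  then interpret C: connected_pair_graph "X i" by (rule factor)
  show ?thesis by (rule C.graph_metric_axioms)
qed

lemma product_dist_pd: "x \<in> PV \<Longrightarrow> y \<in> PV \<Longrightarrow> product_dist N X x y = real (pd x y)"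
  unfolding product_dist_def pd_def of_nat_sum
  by (intro sum.cong refl connected_pair_graph.graph_dist_nat factor PV_in)

lemma PV_nonempty: "PV \<noteq> {}"
proof -
  have "pverts (X i) \<noteq> {}" if "i \<in> {1..N}" for i
    using connected_pair_graph.conn[OF factor[OF that]] by (auto simp: strongly_connected_def)
  then show ?thesis by (auto simp: product_verts_def PiE_eq_empty_iff)
qed

lemma factor_le: "i \<in> {1..N} \<Longrightarrow> nat_dist (X i) (x i) (y i) \<le> pd x y"
  unfolding pd_def by (intro member_le_sum) auto

lemma factor_add:
  assumes "x \<in> PV" "y \<in> PV" "z \<in> PV" "pd x y = pd x z + pd z y" "i \<in> {1..N}"
  shows "nat_dist (X i) (x i) (y i) = nat_dist (X i) (x i) (z i) + nat_dist (X i) (z i) (y i)"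
proof (rule ccontr)
  have le: "nat_dist (X i) (x i) (y i) \<le> nat_dist (X i) (x i) (z i) + nat_dist (X i) (z i) (y i)"
    if "i \<in> {1..N}" for i
    using graph_metric.d_tri[OF factor_metric[OF that]] PV_in assms that by blast
  assume "nat_dist (X i) (x i) (y i) \<noteq> nat_dist (X i) (x i) (z i) + nat_dist (X i) (z i) (y i)"
  with le[OF assms(5)] have "pd x y < (\<Sum>i=1..N. nat_dist (X i) (x i) (z i) + nat_dist (X i) (z i) (y i))"
    unfolding pd_def using assms(5) le by (intro sum_strict_mono_ex1 bexI[of _ i]) (auto simp: less_le)
  with assms(4) show False by (simp add: pd_def sum.distrib)
qed

text \<open>For \<open>d_step\<close>, move one coordinate in which \<open>x\<close> and
  \<open>y\<close> differ by a step in its factor.\<close>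

lemma product_metric: "graph_metric PV pd"
proof
  fix x y assume x: "x \<in> PV" and y: "y \<in> PV"
  have zero: "nat_dist (X i) (x i) (y i) = 0 \<longleftrightarrow> x i = y i" if "i \<in> {1..N}" for i
    using graph_metric.d_zero[OF factor_metric[OF that]] PV_in x y that by blast
  have eq: "x = y \<longleftrightarrow> (\<forall>i\<in>{1..N}. x i = y i)"
    using x y unfolding product_verts_def by (metis PiE_ext)
  show "(pd x y = 0) = (x = y)" unfolding eq pd_def using zero by simp
  show "pd x y = pd y x" unfolding pd_def
    using graph_metric.d_sym[OF factor_metric] PV_in x y by (intro sum.cong) blast+
  show "pd x z \<le> pd x y + pd y z" if "z \<in> PV" for z
    unfolding pd_def sum.distrib[symmetric]
    using graph_metric.d_tri[OF factor_metric] PV_in x y that by (intro sum_mono) blast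
  assume "x \<noteq> y"
  then obtain i where i: "i \<in> {1..N}" "x i \<noteq> y i" using eq by blast
  obtain w where w: "w \<in> pverts (X i)" "nat_dist (X i) (x i) w = 1"
    "nat_dist (X i) (x i) (y i) = Suc (nat_dist (X i) w (y i))"
    using graph_metric.d_step[OF factor_metric[OF i(1)] PV_in[OF x i(1)] PV_in[OF y i(1)] i(2)] by blast
  let ?z = "x(i := w)"
  have z: "?z \<in> PV" using x w i by (auto simp: product_verts_def PiE_def extensional_def Pi_def)
  have split: "pd u v = nat_dist (X i) (u i) (v i) + (\<Sum>k\<in>{1..N} - {i}. nat_dist (X k) (u k) (v k))" for u v
    unfolding pd_def using i by (intro sum.remove) auto
  have "pd x ?z = 1"
    unfolding split using w x PV_in graph_metric.d_refl[OF factor_metric] by (auto intro!: sum.neutral)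
  moreover have "pd x y = Suc (pd ?z y)" unfolding split using w by simp
  ultimately show "\<exists>z\<in>PV. pd x z = 1 \<and> pd x y = Suc (pd z y)" using z by blast
qed

text \<open>Adjacent vertices differ in exactly one coordinate, so the minimum merely names
  it.\<close>

definition dir :: "(nat \<Rightarrow> 'v) \<Rightarrow> (nat \<Rightarrow> 'v) \<Rightarrow> nat" where
  "dir u v = (LEAST i. i \<in> {1..N} \<and> u i \<noteq> v i)"

lemma dir:
  assumes "u \<in> PV" "v \<in> PV" "pd u v = 1"
  shows "dir u v \<in> {1..N}" "u (dir u v) \<noteq> v (dir u v)" "\<And>k. k \<in> {1..N} \<Longrightarrow> k \<noteq> dir u v \<Longrightarrow> u k = v k"
proof -
  have zero: "nat_dist (X i) (u i) (v i) = 0 \<longleftrightarrow> u i = v i" if "i \<in> {1..N}" for i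
    using graph_metric.d_zero[OF factor_metric[OF that]] PV_in assms that by blast
  have "\<exists>i. i \<in> {1..N} \<and> u i \<noteq> v i"
  proof (rule ccontr)
    assume "\<not> ?thesis"
    then have "pd u v = 0" unfolding pd_def using zero by (intro sum.neutral) auto
    with assms show False by simp
  qed
  from LeastI_ex[OF this] show d: "dir u v \<in> {1..N}" "u (dir u v) \<noteq> v (dir u v)" unfolding dir_def by blast+
  fix k assume k: "k \<in> {1..N}" "k \<noteq> dir u v"
  have "nat_dist (X k) (u k) (v k) + nat_dist (X (dir u v)) (u (dir u v)) (v (dir u v)) =
      (\<Sum>i\<in>{k, dir u v}. nat_dist (X i) (u i) (v i))" using k by simp
  also have "\<dots> \<le> pd u v" unfolding pd_def using k d by (intro sum_mono2) auto
  finally have "nat_dist (X k) (u k) (v k) = 0" using zero[OF d(1)] d(2) assms(3) by simp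
  then show "u k = v k" using zero k by blast
qed

text \<open>In each coordinate at least one of the two edges is constant, so the two sums agree
  coordinate by coordinate.\<close>

lemma dir_theta:
  assumes "u \<in> PV" "v \<in> PV" "pd u v = 1" "a \<in> PV" "b \<in> PV" "pd a b = 1" "dir u v \<noteq> dir a b"
  shows "pd u a + pd v b = pd u b + pd v a"
  unfolding pd_def sum.distrib[symmetric]
proof (rule sum.cong[OF refl])
  fix k assume k: "k \<in> {1..N}"
  have "u k = v k \<or> a k = b k" using dir(3)[OF assms(1-3) k] dir(3)[OF assms(4-6) k] assms(7) by blast
  then show "nat_dist (X k) (u k) (a k) + nat_dist (X k) (v k) (b k) =
      nat_dist (X k) (u k) (b k) + nat_dist (X k) (v k) (a k)" by auto
qed

end

section \<open>The invariant colouring of the product by the directions of translates\<close>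

locale product_graph_action = group \<Gamma> + product_graph N X
  for \<Gamma> :: "('g, 'm) monoid_scheme" (structure) and N and X :: "nat \<Rightarrow> 'v pair_pre_digraph" +
  fixes \<phi> :: "'g \<Rightarrow> (nat \<Rightarrow> 'v) \<Rightarrow> nat \<Rightarrow> 'v" and V :: "(nat \<Rightarrow> 'v) set" and b0 :: "nat \<Rightarrow> 'v" and B :: nat
  assumes V: "V \<subseteq> PV" "countable V" "b0 \<in> V" and V_metric: "graph_metric V pd"
    and \<phi>_in: "g \<in> carrier \<Gamma> \<Longrightarrow> x \<in> V \<Longrightarrow> \<phi> g x \<in> V"
    and \<phi>_pd: "g \<in> carrier \<Gamma> \<Longrightarrow> x \<in> V \<Longrightarrow> y \<in> V \<Longrightarrow> pd (\<phi> g x) (\<phi> g y) = pd x y"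
    and \<phi>_one: "x \<in> V \<Longrightarrow> \<phi> \<one> x = x"
    and \<phi>_mult: "g \<in> carrier \<Gamma> \<Longrightarrow> h \<in> carrier \<Gamma> \<Longrightarrow> x \<in> V \<Longrightarrow> \<phi> (g \<otimes> h) x = \<phi> g (\<phi> h x)"
    and \<phi>_proper: "finite {g \<in> carrier \<Gamma>. real (pd b0 (\<phi> g b0)) \<le> R}"
    and factor_tripod: "i \<in> {1..N} \<Longrightarrow> tripod (pverts (X i)) (graph_dist (X i)) 1 (real B)"
begin

text \<open>Recording the directions of all translates makes \<open>\<Gamma>\<close> permute the colours, although it need
  not permute the factors.\<close>

definition colour :: "(nat \<Rightarrow> 'v) \<Rightarrow> (nat \<Rightarrow> 'v) \<Rightarrow> 'g \<Rightarrow> nat" where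
  "colour u v = (\<lambda>g. if g \<in> carrier \<Gamma> then dir (\<phi> g u) (\<phi> g v) else 0)"

text \<open>Right translation by \<open>h\<close> reflects that translating by \<open>h\<close> and
  then by \<open>g\<close> is translating by \<open>g \<otimes> h\<close>.\<close>

definition recolour :: "'g \<Rightarrow> ('g \<Rightarrow> nat) \<Rightarrow> 'g \<Rightarrow> nat" where
  "recolour h c = (\<lambda>g. if g \<in> carrier \<Gamma> then c (g \<otimes> h) else 0)"

text \<open>Isometries preserve the Djokovic--Winkler relation, so all translates of related edges
  are related and by \<open>dir_theta\<close> have equal directions.\<close>

sublocale coloured_graph_metric V pd colour
proof (intro coloured_graph_metric.intro V_metric coloured_graph_metric_axioms.intro)
  interpret graph_metric V pd by (rule V_metric)
  fix u v a b
  assume uv: "adj u v" and ab: "adj a b" and ne: "pd u a + pd v b \<noteq> pd u b + pd v a"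
  note uv = adjD[OF uv] and ab = adjD[OF ab]
  have "dir (\<phi> g u) (\<phi> g v) = dir (\<phi> g a) (\<phi> g b)" if g: "g \<in> carrier \<Gamma>" for g
  proof (rule ccontr)
    assume d: "dir (\<phi> g u) (\<phi> g v) \<noteq> dir (\<phi> g a) (\<phi> g b)"
    have in_PV: "\<phi> g x \<in> PV" if "x \<in> V" for x using V \<phi>_in[OF g that] by blast
    have "pd (\<phi> g u) (\<phi> g a) + pd (\<phi> g v) (\<phi> g b) = pd (\<phi> g u) (\<phi> g b) + pd (\<phi> g v) (\<phi> g a)"
      using uv ab \<phi>_pd[OF g] by (intro dir_theta in_PV d) auto
    with ne show False using uv ab \<phi>_pd[OF g] by simp
  qed
  then show "colour u v = colour a b" by (auto simp: colour_def)
qed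

text \<open>The unit acts trivially, so \<open>c \<one>\<close> is the direction of any edge of
  colour \<open>c\<close>. Each such edge on a geodesic moves in that factor, and factor distances
  add up along the geodesic by \<open>factor_add\<close>.\<close>

lemma D_le_factor:
  assumes "x \<in> V" "y \<in> V" "c \<one> \<in> {1..N}"
  shows "D c x y \<le> nat_dist (X (c \<one>)) (x (c \<one>)) (y (c \<one>))"
proof -
  let ?i = "c \<one>"
  obtain P where P: "geod x P y" using geod_ex assms by blast
  have "cnt c u P \<le> nat_dist (X ?i) (u ?i) (y ?i)" if "geod u P y" "u \<in> V" for u
    using that
  proof (induction P arbitrary: u)
    case (Cons z P)
    then have z: "adj u z" "chain adj z P y" "Suc (length P) = pd u y" by (auto simp: geod_def)
    have zV: "z \<in> V" "u \<in> PV" "z \<in> PV" "y \<in> PV" using adjD(2)[OF z(1)] Cons.prems assms V by auto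
    have "pd u y \<le> pd u z + pd z y" using d_tri Cons.prems zV assms by blast
    then have zy: "geod z P y" "pd u y = pd u z + pd z y"
      using z chain_length[OF z(2) zV(1)] adjD(3)[OF z(1)] by (auto simp: geod_def)
    have "1 \<le> nat_dist (X ?i) (u ?i) (z ?i)" if "colour u z = c"
    proof -
      have "dir u z = ?i" using that \<phi>_one Cons.prems zV by (auto simp: colour_def)
      then have "u ?i \<noteq> z ?i" using dir(2)[OF zV(2,3) adjD(3)[OF z(1)]] by simp
      then have "nat_dist (X ?i) (u ?i) (z ?i) \<noteq> 0"
        using graph_metric.d_zero[OF factor_metric[OF assms(3)]] PV_in zV assms(3) by blast
      then show ?thesis by simp
    qed
    with Cons.IH[OF zy(1) zV(1)] factor_add[OF zV(2,4,3) zy(2) assms(3)] show ?case by auto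
  qed simp
  from this[OF P assms(1)] show ?thesis using D_geod[OF P assms(1)] by simp
qed

lemma D_no_direction:
  assumes "x \<in> V" "y \<in> V" "c \<one> \<notin> {1..N}"
  shows "D c x y = 0"
proof -
  obtain P where P: "geod x P y" using geod_ex assms by blast
  have "cnt c u P = 0" if "chain adj u P y" for u
    using that
  proof (induction P arbitrary: u)
    case (Cons z P)
    then have z: "adj u z" by simp
    have "u \<in> PV" "z \<in> PV" using adjD[OF z] V by auto
    then have "dir u z \<in> {1..N}" using dir(1) adjD(3)[OF z] by blast
    then have "colour u z \<noteq> c" using assms(3) \<phi>_one adjD[OF z] by (auto simp: colour_def)
    with Cons show ?case by simp
  qed simp
  with P show ?thesis using D_geod[OF P assms(1)] by (simp add: geod_def)
qed

text \<open>\<open>D c\<close> is dominated by the distance of the factor \<open>c \<one>\<close>,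
  whose thin triangles pull back along the coordinate; if \<open>c \<one>\<close> is not a
  direction, \<open>D c\<close> vanishes.\<close>

sublocale layered_graph_metric V pd colour b0 B
proof
  show "b0 \<in> V" by (rule V)
  fix x xs y ps qs c
  assume ch: "chain adj x xs y" "chain adj b0 ps x" "chain adj b0 qs y"
  have xy: "x \<in> V" "y \<in> V" using chain_adj_end ch V by blast+
  note sub = chain_adj_in[OF ch(1) xy(1)] chain_adj_in[OF ch(2) V(3)] chain_adj_in[OF ch(3) V(3)]
  show "\<exists>z\<in>insert x (set xs). \<exists>p\<in>insert b0 (set ps). \<exists>q\<in>insert b0 (set qs). D c z p \<le> B \<and> D c z q \<le> B"
  proof (cases "c \<one> \<in> {1..N}")
    case False
    then show ?thesis using D_no_direction xy V by force
  next
    case True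
    let ?i = "c \<one>"
    let ?\<rho> = "\<lambda>x y. real (nat_dist (X ?i) (x ?i) (y ?i))"
    have "tripod V ?\<rho> 1 (real B)"
    proof (rule tripod_pullback[OF factor_tripod[OF True], where f = "\<lambda>x. x ?i"])
      show "(\<lambda>x. x ?i) \<in> V \<rightarrow> pverts (X ?i)" using V PV_in True by blast
      fix x y assume "x \<in> V" "y \<in> V"
      then have "graph_dist (X ?i) (x ?i) (y ?i) = ?\<rho> x y"
        using V PV_in True by (intro connected_pair_graph.graph_dist_nat factor) blast+
      then show "?\<rho> x y \<le> 1 \<Longrightarrow> graph_dist (X ?i) (x ?i) (y ?i) \<le> 1"
        "graph_dist (X ?i) (x ?i) (y ?i) \<le> real B \<Longrightarrow> ?\<rho> x y \<le> real B" by simp_all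
    qed
    note tripod_i = this[unfolded tripod_def, rule_format]
    have ch_i: "chain (\<lambda>u v. u \<in> V \<and> v \<in> V \<and> ?\<rho> u v \<le> 1) u us v" if "chain adj u us v" for u us v
      using that
    proof (rule chain_mono)
      fix u v assume uv: "adj u v"
      have "nat_dist (X ?i) (u ?i) (v ?i) \<le> pd u v" using factor_le True by blast
      with adjD[OF uv] show "u \<in> V \<and> v \<in> V \<and> ?\<rho> u v \<le> 1" by simp
    qed
    obtain z p q where z: "z\<in>insert x (set xs)" "p\<in>insert b0 (set ps)" "q\<in>insert b0 (set qs)"
      "?\<rho> z p \<le> real B" "?\<rho> z q \<le> real B"
      using tripod_i[OF V(3) xy ch_i[OF ch(1)] ch_i[OF ch(2)] ch_i[OF ch(3)]] by blast
    have zpq: "z \<in> V" "p \<in> V" "q \<in> V" using z(1-3) sub by blast+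
    have "D c z p \<le> B" "D c z q \<le> B"
      using D_le_factor[of z p c, OF zpq(1,2) True] D_le_factor[of z q c, OF zpq(1,3) True] z(4,5) by linarith+
    with z show ?thesis by blast
  qed
qed

lemma isometry:
  assumes g: "g \<in> carrier \<Gamma>"
  shows "layered_isometry V pd colour b0 B (\<phi> g) (recolour g) {c. \<forall>h. h \<notin> carrier \<Gamma> \<longrightarrow> c h = 0}"
proof
  show "\<phi> g x \<in> V" if "x \<in> V" for x using \<phi>_in[OF g that] .
  show "pd (\<phi> g x) (\<phi> g y) = pd x y" if "x \<in> V" "y \<in> V" for x y using \<phi>_pd[OF g that] .
  show "colour u v \<in> {c. \<forall>h. h \<notin> carrier \<Gamma> \<longrightarrow> c h = 0}" for u v by (auto simp: colour_def)
  show "colour (\<phi> g u) (\<phi> g v) = recolour g (colour u v)" if "adj u v" for u v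
    using \<phi>_mult[OF _ g] g adjD[OF that] by (intro ext) (simp add: colour_def recolour_def)
  show "inj_on (recolour g) {c. \<forall>h. h \<notin> carrier \<Gamma> \<longrightarrow> c h = 0}"
  proof (intro inj_onI ext)
    fix c c' h assume cc: "c \<in> {c. \<forall>h. h \<notin> carrier \<Gamma> \<longrightarrow> c h = 0}" "c' \<in> {c. \<forall>h. h \<notin> carrier \<Gamma> \<longrightarrow> c h = 0}"
      and eq: "recolour g c = recolour g c'"
    show "c h = c' h"
    proof (cases "h \<in> carrier \<Gamma>")
      case True
      \<comment> \<open>Evaluation at \<open>h \<otimes> inv g\<close> recovers the value of the
        colour at \<open>h\<close>.\<close>
      then have "recolour g c (h \<otimes> inv g) = c h" "recolour g c' (h \<otimes> inv g) = c' h"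
        using g by (simp_all add: recolour_def m_assoc)
      with eq show ?thesis by simp
    qed (use cc in auto)
  qed
qed

text \<open>\<open>kern_sum\<close> at the point \<open>\<phi> h b0\<close> is the cocycle identity
  for the indicators of \<open>all_cuts\<close>, and the bound of \<open>kern_norm\<close> is the
  same for all group elements.\<close>

lemma cuts_cocycle:
  "\<exists>A. kernel_cocycle \<Gamma> (\<Union>x\<in>V. all_cuts x) A (\<lambda>g. all_cuts (\<phi> g b0)) (4 * real (6 * B + 1))"
proof -
  define J where "J = (\<Union>x\<in>V. all_cuts x)"
  have fin: "finite (all_cuts x)" "all_cuts x \<subseteq> J" "pd b0 x \<le> card (all_cuts x)" if "x \<in> V" for x
    using all_cuts_finite_card[OF that] that by (auto simp: J_def)
  have orbit: "\<phi> g b0 \<in> V" if "g \<in> carrier \<Gamma>" for g using \<phi>_in[OF that] V by blast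
  define bounded where "bounded A \<longleftrightarrow> (\<forall>j\<in>J. \<exists>U. finite U \<and> U \<subseteq> J \<and> (\<forall>i\<in>J - U. A j i = 0) \<and>
    (\<Sum>i\<in>U. \<bar>A j i\<bar>) \<le> 4 * real (6 * B + 1))" for A :: "('g \<Rightarrow> nat) \<times> nat \<times> (nat \<Rightarrow> 'v) set \<Rightarrow> ('g \<Rightarrow> nat) \<times> nat \<times> (nat \<Rightarrow> 'v) set \<Rightarrow> real"
  define equi where "equi g A \<longleftrightarrow> (\<forall>x\<in>V. \<forall>i. (\<Sum>j\<in>all_cuts x. A j i) =
    of_bool (i \<in> all_cuts (\<phi> g x)) - of_bool (i \<in> all_cuts (\<phi> g b0)))"
    for g and A :: "('g \<Rightarrow> nat) \<times> nat \<times> (nat \<Rightarrow> 'v) set \<Rightarrow> ('g \<Rightarrow> nat) \<times> nat \<times> (nat \<Rightarrow> 'v) set \<Rightarrow> real"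
  have "\<exists>A. bounded A \<and> equi g A"
    if g: "g \<in> carrier \<Gamma>" for g
  proof -
    interpret I: layered_isometry V pd colour b0 B "\<phi> g" "recolour g" "{c. \<forall>h. h \<notin> carrier \<Gamma> \<longrightarrow> c h = 0}"
      by (rule isometry[OF g])
    have "\<exists>U. finite U \<and> U \<subseteq> J \<and> (\<forall>i\<in>J - U. I.kern j i = 0) \<and>
        (\<Sum>i\<in>U. \<bar>I.kern j i\<bar>) \<le> 4 * real (6 * B + 1)" if j: "j \<in> J" for j
    proof -
      obtain x where x: "x \<in> V" "j \<in> all_cuts x" using j unfolding J_def by blast
      from I.kern_norm[OF x] show ?thesis unfolding J_def by blast
    qed
    then have "bounded I.kern" unfolding bounded_def by blast
    moreover have "equi g I.kern" unfolding equi_def using I.kern_sum by (simp add: I.ind_def)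
    ultimately show ?thesis by blast
  qed
  then obtain A where A: "\<And>g. g \<in> carrier \<Gamma> \<Longrightarrow> bounded (A g)" "\<And>g. g \<in> carrier \<Gamma> \<Longrightarrow> equi g (A g)"
    by metis
  have "kernel_cocycle \<Gamma> J A (\<lambda>g. all_cuts (\<phi> g b0)) (4 * real (6 * B + 1))"
  proof
    show "countable J" unfolding J_def by (intro countable_UN[OF V(2)] countable_finite fin)
    show "all_cuts (\<phi> \<one> b0) = {}" using \<phi>_one V all_cuts_base by simp
    show "of_bool (i \<in> all_cuts (\<phi> (g \<otimes> h) b0)) =
      (\<Sum>j\<in>all_cuts (\<phi> h b0). A g j i) + of_bool (i \<in> all_cuts (\<phi> g b0))"
      if "g \<in> carrier \<Gamma>" "h \<in> carrier \<Gamma>" for g h i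
      using A(2)[OF that(1), unfolded equi_def, rule_format, OF orbit[OF that(2)], of i] \<phi>_mult[OF that V(3)]
      by simp
    show "finite {g \<in> carrier \<Gamma>. real (card (all_cuts (\<phi> g b0))) \<le> R}" for R
    proof (rule finite_subset)
      have "real (pd b0 (\<phi> g b0)) \<le> real (card (all_cuts (\<phi> g b0)))" if "g \<in> carrier \<Gamma>" for g
        using fin(3)[OF orbit[OF that]] by simp
      then show "{g \<in> carrier \<Gamma>. real (card (all_cuts (\<phi> g b0))) \<le> R} \<subseteq> {g \<in> carrier \<Gamma>. real (pd b0 (\<phi> g b0)) \<le> R}"
        using order_trans by blast
    qed (rule \<phi>_proper)
    show "\<exists>U. finite U \<and> U \<subseteq> J \<and> (\<forall>i\<in>J - U. A g j i = 0) \<and> (\<Sum>i\<in>U. \<bar>A g j i\<bar>) \<le> 4 * real (6 * B + 1)"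
      if "g \<in> carrier \<Gamma>" "j \<in> J" for g j
      using A(1)[OF that(1)] that(2) unfolding bounded_def by blast
  qed (use fin orbit in auto)
  then show ?thesis unfolding J_def by blast
qed

end

theorem theorem1p3:
  fixes \<Gamma> :: "('g, 'm) monoid_scheme"
    and N :: nat
    and X :: "nat \<Rightarrow> 'v pair_pre_digraph"
    and \<phi> :: "'g \<Rightarrow> (nat \<Rightarrow> 'v) \<Rightarrow> (nat \<Rightarrow> 'v)"
  assumes "group \<Gamma>" and "countable (carrier \<Gamma>)"
    and "\<And>i. i \<in> {1..N} \<Longrightarrow> quasi_tree TYPE('w) (X i)"
    and "isometric_action \<Gamma> (product_verts N X) (product_dist N X) \<phi>"
    and "proper_action \<Gamma> (product_verts N X) (product_dist N X) \<phi>"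
  shows "\<exists>(M :: real measure) S E \<pi> b.
    closed_subspace S (L1 M) \<and> E = subspace_of (L1 M) S \<and>
    affine_action \<Gamma> E \<pi> b \<and>
    uniformly_Lipschitz \<Gamma> E (affine_map E \<pi> b) \<and>
    proper_action \<Gamma> (vecs E) (vdist E) (affine_map E \<pi> b)"
proof -
  interpret P: product_graph N X
  proof (rule product_graph.intro)
    show "connected_pair_graph (X i)" if "i \<in> {1..N}" for i
      using assms(3)[OF that] unfolding quasi_tree_def connected_pair_graph_iff by blast
  qed
  interpret PM: graph_metric P.PV P.pd by (rule P.product_metric)
  interpret act: group_action \<Gamma> P.PV \<phi> using assms(4) by (simp add: isometric_action_def)
  interpret group \<Gamma> by (rule assms(1))
  have in_PV: "\<phi> g x \<in> P.PV" if "g \<in> carrier \<Gamma>" "x \<in> P.PV" for g x using act.element_image[OF that refl] .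
  obtain b0 where b0: "b0 \<in> P.PV" using P.PV_nonempty by blast
  \<comment> \<open>\<open>nx x y\<close> is the first step from \<open>x\<close> towards a
    different \<open>y\<close>; closure under it makes the countable set \<open>V\<close> a graph
    metric again.\<close>
  obtain nx where nx: "\<And>x y. x \<in> P.PV \<Longrightarrow> y \<in> P.PV \<Longrightarrow> nx x y \<in> P.PV"
    "\<And>x y. x \<in> P.PV \<Longrightarrow> y \<in> P.PV \<Longrightarrow> x \<noteq> y \<Longrightarrow> P.pd x (nx x y) = 1 \<and> P.pd x y = Suc (P.pd (nx x y) y)"
  proof -
    have "\<exists>z\<in>P.PV. x \<noteq> y \<longrightarrow> P.pd x z = 1 \<and> P.pd x y = Suc (P.pd z y)" if "x \<in> P.PV" "y \<in> P.PV" for x y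
      using PM.d_step that by blast
    then show thesis using that by metis
  qed
  obtain V where V: "V \<subseteq> P.PV" "countable V" "b0 \<in> V" "\<forall>g\<in>carrier \<Gamma>. \<forall>x\<in>V. \<phi> g x \<in> V" "\<forall>x\<in>V. \<forall>y\<in>V. nx x y \<in> V"
    using countable_closure[of "carrier \<Gamma>" b0 P.PV \<phi> nx] assms(2) b0 in_PV nx(1) by blast
  have VPV: "x \<in> P.PV" if "x \<in> V" for x using V(1) that by blast
  have "\<exists>B. tripod (pverts (X i)) (graph_dist (X i)) 1 B" if "i \<in> {1..N}" for i
    using quasi_tree_tripod[OF assms(3)[OF that]] .
  then obtain Bf where Bf: "\<And>i. i \<in> {1..N} \<Longrightarrow> tripod (pverts (X i)) (graph_dist (X i)) 1 (Bf i)" by metis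
  \<comment> \<open>A single natural number that bounds the constants of all factors.\<close>
  define B where "B = nat \<lceil>\<Sum>i=1..N. \<bar>Bf i\<bar>\<rceil>"
  have tripod: "tripod (pverts (X i)) (graph_dist (X i)) 1 (real B)" if i: "i \<in> {1..N}" for i
  proof -
    have "Bf i \<le> \<bar>Bf i\<bar>" by simp
    also have "\<dots> \<le> (\<Sum>i=1..N. \<bar>Bf i\<bar>)" using i by (intro member_le_sum) auto
    also have "\<dots> \<le> real B" unfolding B_def by linarith
    finally have "Bf i \<le> real B" .
    then show ?thesis by (intro tripod_pullback[OF Bf[OF i], where f = "\<lambda>x. x"]) auto
  qed
  have pd: "P.pd (\<phi> g x) (\<phi> g y) = P.pd x y" if "g \<in> carrier \<Gamma>" "x \<in> P.PV" "y \<in> P.PV" for g x y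
  proof -
    have "product_dist N X (\<phi> g x) (\<phi> g y) = product_dist N X x y"
      using assms(4) that by (simp add: isometric_action_def)
    then show ?thesis using that in_PV by (simp add: P.product_dist_pd)
  qed
  interpret A: product_graph_action \<Gamma> N X \<phi> V b0 B
  proof (intro product_graph_action.intro product_graph_action_axioms.intro assms(1) P.product_graph_axioms)
    show "graph_metric V P.pd"
    proof (rule PM.graph_metric_subset[OF V(1)])
      fix x y assume xy: "x \<in> V" "y \<in> V" "x \<noteq> y"
      then show "\<exists>z\<in>V. P.pd x z = 1 \<and> P.pd x y = Suc (P.pd z y)"
        using V(5) nx(2)[OF VPV[OF xy(1)] VPV[OF xy(2)] xy(3)] by blast
    qed
    show "\<phi> g x \<in> V" if "g \<in> carrier \<Gamma>" "x \<in> V" for g x using V(4) that by blast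
    show "P.pd (\<phi> g x) (\<phi> g y) = P.pd x y" if "g \<in> carrier \<Gamma>" "x \<in> V" "y \<in> V" for g x y
      using pd[OF that(1) VPV[OF that(2)] VPV[OF that(3)]] .
    show "\<phi> \<one>\<^bsub>\<Gamma>\<^esub> x = x" if "x \<in> V" for x 
      using fun_cong[OF act.id_eq_one, of x] VPV[OF that] by simp
    show "\<phi> (g \<otimes>\<^bsub>\<Gamma>\<^esub> h) x = \<phi> g (\<phi> h x)" if "g \<in> carrier \<Gamma>" "h \<in> carrier \<Gamma>" "x \<in> V" for g h x
      using act.composition_rule[OF VPV[OF that(3)] that(1,2)] .
    show "finite {g \<in> carrier \<Gamma>. real (P.pd b0 (\<phi> g b0)) \<le> R}" for R
    proof -
      \<comment> \<open>\<open>proper_action\<close> speaks of positive radii, hence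
        \<open>max R 1\<close>.\<close>
      have fin: "finite {g \<in> carrier \<Gamma>. product_dist N X (\<phi> g b0) b0 \<le> max R 1}"
        using assms(5) b0 by (simp add: proper_action_def)
      have eq: "product_dist N X (\<phi> g b0) b0 = real (P.pd b0 (\<phi> g b0))" if "g \<in> carrier \<Gamma>" for g
        using in_PV[OF that b0] b0 PM.d_sym[of b0 "\<phi> g b0"] by (simp add: P.product_dist_pd)
      have "{g \<in> carrier \<Gamma>. real (P.pd b0 (\<phi> g b0)) \<le> R} \<subseteq>
          {g \<in> carrier \<Gamma>. product_dist N X (\<phi> g b0) b0 \<le> max R 1}"
        using eq by auto
      then show ?thesis using fin by (rule finite_subset)
    qed
  qed (fact V(1) V(2) V(3) tripod)+
  show ?thesis using A.cuts_cocycle kernel_cocycle.L1_real_action by blast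
qed

end
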